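(* There is a $3$-approximation algorithm for the Label-consistent $k$-center problem running in time $O(n^2\log n + nk\log n)$, where $n=|X|$.
   Context: Let $(X,d)$ be a finite metric space with $n=|X|$ points. A $k$-clustering of $X$ is a pair $\mathcal{C}=(C,\ell_C)$ where $C\subseteq X$ is a set of $k$ centers and $\ell_C:X\to C$ is a labeling function assigning each point to a center (not necessarily the closest one). Its $k$-center cost is $\mathrm{cost}_\infty(\mathcal{C})=\max_{x\in X} d(x,\ell_C(x))$. For two $k$-clusterings $\mathcal{C}_1=(C_1,\ell_1)$, $\mathcal{C}_2=(C_2,\ell_2)$ of $X$, $\Delta(\mathcal{C}_1,\mathcal{C}_2)=|\{x\in X:\ell_1(x)\neq\ell_2(x)\}|$. Label-consistent $k$-center: given $(X,d)$, positive integers $k,b$, and a historical $k$-clustering $\mathcal{H}=(H,\ell_H)$ of $X$ with $|H|=k$, find a $k$-clustering $\mathcal{C}=(C,\ell_C)$ of $X$ with $|C|=k$ and $\Delta(\mathcal{H},\mathcal{C})\le b$ (a feasible solution) minimizing $\mathrm{cost}_\infty(\mathcal{C})$; $r^*$ denotes the optimal cost. A $3$-approximation algorithm returns a feasible solution of cost at most $3r^*$. *)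

theory Defs
  imports "HOL-Analysis.Analysis"
begin

type_synonym 'a clustering = "'a set \<times> ('a \<Rightarrow> 'a)"

definition is_clustering :: "'a set \<Rightarrow> nat \<Rightarrow> 'a clustering \<Rightarrow> bool" where
  "is_clustering X k \<C> \<longleftrightarrow>
     fst \<C> \<subseteq> X \<and> card (fst \<C>) = k \<and> snd \<C> \<in> X \<rightarrow> fst \<C>"

definition cost_inf :: "'a set \<Rightarrow> ('a \<Rightarrow> 'a \<Rightarrow> real) \<Rightarrow> 'a clustering \<Rightarrow> real" where
  "cost_inf X d \<C> = Max ((\<lambda>x. d x (snd \<C> x)) ` X)"

definition label_diff :: "'a set \<Rightarrow> 'a clustering \<Rightarrow> 'a clustering \<Rightarrow> nat" where
  "label_diff X \<C>\<^sub>1 \<C>\<^sub>2 = card {x \<in> X. snd \<C>\<^sub>1 x \<noteq> snd \<C>\<^sub>2 x}"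

definition lc_instance ::
  "'a set \<Rightarrow> ('a \<Rightarrow> 'a \<Rightarrow> real) \<Rightarrow> nat \<Rightarrow> nat \<Rightarrow> 'a clustering \<Rightarrow> bool" where
  "lc_instance X d k b \<H> \<longleftrightarrow>
     finite X \<and> Metric_space X d \<and> 0 < k \<and> 0 < b \<and> is_clustering X k \<H>"

definition lc_feasible ::
  "'a set \<Rightarrow> nat \<Rightarrow> nat \<Rightarrow> 'a clustering \<Rightarrow> 'a clustering \<Rightarrow> bool" where
  "lc_feasible X k b \<H> \<C> \<longleftrightarrow> is_clustering X k \<C> \<and> label_diff X \<H> \<C> \<le> b"

definition lc_opt ::
  "'a set \<Rightarrow> ('a \<Rightarrow> 'a \<Rightarrow> real) \<Rightarrow> nat \<Rightarrow> nat \<Rightarrow> 'a clustering \<Rightarrow> real" where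
  "lc_opt X d k b \<H> = Min (cost_inf X d ` {\<C>. lc_feasible X k b \<H> \<C>})"

text \<open>
  The set under the minimum in \<^const>\<open>lc_opt\<close> is finite and nonempty, although there are
  infinitely many feasible pairs when labelings may take arbitrary values outside \<open>X\<close>.
\<close>

lemma lc_opt_attained:
  assumes "lc_instance X d k b \<H>"
  shows "\<exists>\<C>. lc_feasible X k b \<H> \<C> \<and> cost_inf X d \<C> = lc_opt X d k b \<H>"
    and "\<And>\<C>. lc_feasible X k b \<H> \<C> \<Longrightarrow> lc_opt X d k b \<H> \<le> cost_inf X d \<C>"
proof -
  let ?F = "{\<C>. lc_feasible X k b \<H> \<C>}"
  have X: "finite X" and H: "is_clustering X k \<H>" and k: "0 < k"
    using assms by (auto simp: lc_instance_def)
  have ne: "X \<noteq> {}"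
    using H k by (auto simp: is_clustering_def)
  have "\<H> \<in> ?F"
    using H by (simp add: lc_feasible_def label_diff_def)
  then have F: "cost_inf X d ` ?F \<noteq> {}" by blast
  have "cost_inf X d ` ?F \<subseteq> (\<lambda>(x, y). d x y) ` (X \<times> X)"
  proof
    fix r assume "r \<in> cost_inf X d ` ?F"
    then obtain \<C> where C: "is_clustering X k \<C>" and r: "r = cost_inf X d \<C>"
      by (auto simp: lc_feasible_def)
    have "r \<in> (\<lambda>x. d x (snd \<C> x)) ` X"
      unfolding r cost_inf_def using X ne by (intro Max_in) auto
    then show "r \<in> (\<lambda>(x, y). d x y) ` (X \<times> X)"
      using C by (force simp: is_clustering_def)
  qed
  then have fin: "finite (cost_inf X d ` ?F)"
    by (rule finite_subset) (use X in simp)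
  show "\<exists>\<C>. lc_feasible X k b \<H> \<C> \<and> cost_inf X d \<C> = lc_opt X d k b \<H>"
    using Min_in[OF fin F] unfolding lc_opt_def by (metis (mono_tags) imageE mem_Collect_eq)
  show "\<And>\<C>. lc_feasible X k b \<H> \<C> \<Longrightarrow> lc_opt X d k b \<H> \<le> cost_inf X d \<C>"
    unfolding lc_opt_def using fin by (intro Min_le) auto
qed

text \<open>
  Programs are while programs over scalar variables and unbounded zero-based arrays, holding
  either natural numbers or exact reals. Every operator, variable access, array access and
  assignment or test costs one unit. The operations are kept weak enough for unit cost to be
  reasonable: there is no multiplication, and reals can only be copied, added, subtracted and
  compared; there is no conversion between the two sorts.
\<close>

type_synonym vname = string

datatype nexp =
    NConst nat
  | NVar vname
  | NArr vname nexp
  | NPlus nexp nexp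
  | NMinus nexp nexp
  | NHalf nexp

datatype rexp =
    RVar vname
  | RArr vname nexp
  | RPlus rexp rexp
  | RMinus rexp rexp

datatype bexp =
    NLess nexp nexp
  | RLess rexp rexp
  | BNot bexp
  | BAnd bexp bexp

datatype com =
    Skip
  | NAssign vname nexp
  | NStore vname nexp nexp
  | RAssign vname rexp
  | RStore vname nexp rexp
  | Seq com com
  | Cond bexp com com
  | Loop bexp com

record store =
  nvar :: "vname \<Rightarrow> nat"
  narr :: "vname \<Rightarrow> nat \<Rightarrow> nat"
  rvar :: "vname \<Rightarrow> real"
  rarr :: "vname \<Rightarrow> nat \<Rightarrow> real"

fun nval :: "nexp \<Rightarrow> store \<Rightarrow> nat" where
  "nval (NConst m) s = m"
| "nval (NVar x) s = nvar s x"
| "nval (NArr a e) s = narr s a (nval e s)"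
| "nval (NPlus e f) s = nval e s + nval f s"
| "nval (NMinus e f) s = nval e s - nval f s"
| "nval (NHalf e) s = nval e s div 2"

fun rval :: "rexp \<Rightarrow> store \<Rightarrow> real" where
  "rval (RVar x) s = rvar s x"
| "rval (RArr a e) s = rarr s a (nval e s)"
| "rval (RPlus e f) s = rval e s + rval f s"
| "rval (RMinus e f) s = rval e s - rval f s"

fun bval :: "bexp \<Rightarrow> store \<Rightarrow> bool" where
  "bval (NLess e f) s \<longleftrightarrow> nval e s < nval f s"
| "bval (RLess e f) s \<longleftrightarrow> rval e s < rval f s"
| "bval (BNot p) s \<longleftrightarrow> \<not> bval p s"
| "bval (BAnd p q) s \<longleftrightarrow> bval p s \<and> bval q s"

fun ncost :: "nexp \<Rightarrow> nat" where
  "ncost (NConst m) = 1"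
| "ncost (NVar x) = 1"
| "ncost (NArr a e) = ncost e + 1"
| "ncost (NPlus e f) = ncost e + ncost f + 1"
| "ncost (NMinus e f) = ncost e + ncost f + 1"
| "ncost (NHalf e) = ncost e + 1"

fun rcost :: "rexp \<Rightarrow> nat" where
  "rcost (RVar x) = 1"
| "rcost (RArr a e) = ncost e + 1"
| "rcost (RPlus e f) = rcost e + rcost f + 1"
| "rcost (RMinus e f) = rcost e + rcost f + 1"

fun bcost :: "bexp \<Rightarrow> nat" where
  "bcost (NLess e f) = ncost e + ncost f + 1"
| "bcost (RLess e f) = rcost e + rcost f + 1"
| "bcost (BNot p) = bcost p + 1"
| "bcost (BAnd p q) = bcost p + bcost q + 1"

text \<open>\<open>exec c s t s'\<close>: started in \<open>s\<close>, program \<open>c\<close> halts in \<open>s'\<close> after \<open>t\<close> time units.\<close>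

inductive exec :: "com \<Rightarrow> store \<Rightarrow> nat \<Rightarrow> store \<Rightarrow> bool" where
  Skip: "exec Skip s 1 s"
| NAssign: "exec (NAssign x e) s (ncost e + 1) (s\<lparr>nvar := (nvar s)(x := nval e s)\<rparr>)"
| NStore: "exec (NStore a i e) s (ncost i + ncost e + 1)
    (s\<lparr>narr := (narr s)(a := (narr s a)(nval i s := nval e s))\<rparr>)"
| RAssign: "exec (RAssign x e) s (rcost e + 1) (s\<lparr>rvar := (rvar s)(x := rval e s)\<rparr>)"
| RStore: "exec (RStore a i e) s (ncost i + rcost e + 1)
    (s\<lparr>rarr := (rarr s)(a := (rarr s a)(nval i s := rval e s))\<rparr>)"
| Seq: "exec c s t s' \<Longrightarrow> exec c' s' t' s'' \<Longrightarrow> exec (Seq c c') s (t + t') s''"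
| CondTrue: "bval p s \<Longrightarrow> exec c s t s' \<Longrightarrow> exec (Cond p c c') s (bcost p + 1 + t) s'"
| CondFalse: "\<not> bval p s \<Longrightarrow> exec c' s t s' \<Longrightarrow> exec (Cond p c c') s (bcost p + 1 + t) s'"
| LoopFalse: "\<not> bval p s \<Longrightarrow> exec (Loop p c) s (bcost p + 1) s"
| LoopTrue: "bval p s \<Longrightarrow> exec c s t s' \<Longrightarrow> exec (Loop p c) s' t' s'' \<Longrightarrow>
    exec (Loop p c) s (bcost p + 1 + t + t') s''"

inductive_cases exec_SkipE: "exec Skip s t s'"
inductive_cases exec_NAssignE: "exec (NAssign x e) s t s'"
inductive_cases exec_NStoreE: "exec (NStore a i e) s t s'"
inductive_cases exec_RAssignE: "exec (RAssign x e) s t s'"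
inductive_cases exec_RStoreE: "exec (RStore a i e) s t s'"
inductive_cases exec_SeqE: "exec (Seq c c') s t s'"
inductive_cases exec_CondE: "exec (Cond p c c') s t s'"
inductive_cases exec_LoopE: "exec (Loop p c) s t s'"

lemma exec_deterministic:
  assumes "exec c s t s'" and "exec c s u s''"
  shows "t = u \<and> s' = s''"
  using assms
proof (induction arbitrary: u s'' rule: exec.induct)
  case (Skip s)
  from Skip.prems show ?case by (rule exec_SkipE) simp
next
  case (NAssign x e s)
  from NAssign.prems show ?case by (rule exec_NAssignE) simp
next
  case (NStore a i e s)
  from NStore.prems show ?case by (rule exec_NStoreE) simp
next
  case (RAssign x e s)
  from RAssign.prems show ?case by (rule exec_RAssignE) simp
next
  case (RStore a i e s)
  from RStore.prems show ?case by (rule exec_RStoreE) simp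
next
  case (Seq c s t s' c' t' s3)
  from Seq.prems show ?case by (rule exec_SeqE) (metis Seq.IH)
next
  case (CondTrue p s c t s' c')
  from CondTrue.prems show ?case by (rule exec_CondE; auto simp: CondTrue.hyps(1) dest!: CondTrue.IH)
next
  case (CondFalse p s c' t s' c)
  from CondFalse.prems show ?case by (rule exec_CondE; auto simp: CondFalse.hyps(1) dest!: CondFalse.IH)
next
  case (LoopFalse p s c)
  from LoopFalse.prems show ?case by (rule exec_LoopE) (simp_all add: LoopFalse.hyps)
next
  case (LoopTrue p s c t s' t' s3)
  from LoopTrue.prems show ?case by (rule exec_LoopE; auto simp: LoopTrue.hyps(1) dest!: LoopTrue.IH)
qed

text \<open>
  The points are presented through an enumeration \<open>pt\<close>, a bijection from \<open>{..<card X}\<close> to \<open>X\<close>;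
  the program only sees indices. The distance matrix is stored row by row, sets of centers
  are stored as characteristic vectors.
\<close>

definition index_of :: "'a set \<Rightarrow> (nat \<Rightarrow> 'a) \<Rightarrow> 'a \<Rightarrow> nat" where
  "index_of X pt = the_inv_into {..<card X} pt"

definition lc_input ::
  "'a set \<Rightarrow> ('a \<Rightarrow> 'a \<Rightarrow> real) \<Rightarrow> (nat \<Rightarrow> 'a) \<Rightarrow> nat \<Rightarrow> nat \<Rightarrow> 'a clustering \<Rightarrow> store" where
  "lc_input X d pt k b \<H> = (let n = card X in
     \<lparr> nvar = (\<lambda>_. 0)(''n'' := n, ''k'' := k, ''b'' := b),
       narr = (\<lambda>_ _. 0)(
         ''H'' := (\<lambda>i. if i < n \<and> pt i \<in> fst \<H> then 1 else 0),
         ''lH'' := (\<lambda>i. if i < n then index_of X pt (snd \<H> (pt i)) else 0)),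
       rvar = (\<lambda>_. 0),
       rarr = (\<lambda>_ _. 0)(
         ''d'' := (\<lambda>m. if m < n * n then d (pt (m div n)) (pt (m mod n)) else 0)) \<rparr>)"

definition lc_output :: "'a set \<Rightarrow> (nat \<Rightarrow> 'a) \<Rightarrow> store \<Rightarrow> 'a clustering" where
  "lc_output X pt s =
     (pt ` {i \<in> {..<card X}. narr s ''C'' i \<noteq> 0},
      \<lambda>x. pt (narr s ''lC'' (index_of X pt x)))"

end

theory Submission
  imports Defs "HOL-Library.Log_Nat"
begin

text \<open>
  For a guessed radius \<open>r\<close>, choose greedily a maximal set \<open>S\<close> of points at pairwise distance more
  than \<open>2r\<close>. A solution of cost at most \<open>r\<close> has a center within \<open>r\<close> of every \<open>s \<in> S\<close>, and these
  centers are distinct, so \<open>|S| \<le> k\<close>. Weigh a center \<open>h\<close> by the number of points within \<open>r\<close> of \<open>h\<close>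
  that carry the historical label \<open>h\<close>, that is, by the number of labels that keeping \<open>h\<close> preserves.
  For each \<open>s \<in> S\<close>, take the heaviest historical center within \<open>r\<close> of \<open>s\<close>, or \<open>s\<close> itself if there
  is none, and fill the remaining \<open>k - |S|\<close> places with the heaviest remaining historical centers.
  By an exchange argument no solution of cost at most \<open>r\<close> preserves more labels. Every point that does
  not keep its label is within \<open>2r\<close> of some \<open>s \<in> S\<close>, hence within \<open>3r\<close> of the center chosen for \<open>s\<close>.
  The optimal cost is one of the \<open>n\<^sup>2\<close> distances, and binary search over the sorted distances needs
  \<open>O(log n)\<close> guesses, each taking time \<open>O(n\<^sup>2)\<close>; sorting also takes time \<open>O(n\<^sup>2 log n)\<close>.
\<close>

section \<open>Timed total correctness\<close>

datatype location = NatVar vname | NatArr vname | RealVar vname | RealArr vname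

fun written :: "com \<Rightarrow> location set" where
  "written Skip = {}"
| "written (NAssign x e) = {NatVar x}"
| "written (NStore a i e) = {NatArr a}"
| "written (RAssign x e) = {RealVar x}"
| "written (RStore a i e) = {RealArr a}"
| "written (Seq c c') = written c \<union> written c'"
| "written (Cond p c c') = written c \<union> written c'"
| "written (Loop p c) = written c"

definition eq_except :: "location set \<Rightarrow> store \<Rightarrow> store \<Rightarrow> bool" where
  "eq_except W s s' \<longleftrightarrow>
     (\<forall>x. NatVar x \<notin> W \<longrightarrow> nvar s' x = nvar s x) \<and>
     (\<forall>x. NatArr x \<notin> W \<longrightarrow> narr s' x = narr s x) \<and>
     (\<forall>x. RealVar x \<notin> W \<longrightarrow> rvar s' x = rvar s x) \<and>
     (\<forall>x. RealArr x \<notin> W \<longrightarrow> rarr s' x = rarr s x)"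

lemma eq_exceptD:
  assumes "eq_except W s s'"
  shows "NatVar x \<notin> W \<Longrightarrow> nvar s' x = nvar s x"
    and "NatArr x \<notin> W \<Longrightarrow> narr s' x = narr s x"
    and "RealVar x \<notin> W \<Longrightarrow> rvar s' x = rvar s x"
    and "RealArr x \<notin> W \<Longrightarrow> rarr s' x = rarr s x"
  using assms by (auto simp: eq_except_def)

lemma eq_except_refl: "eq_except W s s"
  by (simp add: eq_except_def)

lemma eq_except_trans: "eq_except W s s' \<Longrightarrow> eq_except W s' s'' \<Longrightarrow> eq_except W s s''"
  by (simp add: eq_except_def)

lemma exec_eq_except: "exec c s t s' \<Longrightarrow> eq_except (written c) s s'"
  by (induction rule: exec.induct) (auto simp: eq_except_def)

text \<open>\<open>rounds p\<close> bounds the number of iterations of a loop with test \<open>p\<close>, each time it is entered.\<close>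

fun time_bound :: "(bexp \<Rightarrow> nat) \<Rightarrow> com \<Rightarrow> nat" where
  "time_bound rounds Skip = 1"
| "time_bound rounds (NAssign x e) = ncost e + 1"
| "time_bound rounds (NStore a i e) = ncost i + ncost e + 1"
| "time_bound rounds (RAssign x e) = rcost e + 1"
| "time_bound rounds (RStore a i e) = ncost i + rcost e + 1"
| "time_bound rounds (Seq c c') = time_bound rounds c + time_bound rounds c'"
| "time_bound rounds (Cond p c c') = bcost p + 1 + time_bound rounds c + time_bound rounds c'"
| "time_bound rounds (Loop p c) = rounds p * (bcost p + 1 + time_bound rounds c) + (bcost p + 1)"

fun iterations :: "(bexp \<Rightarrow> nat) \<Rightarrow> com \<Rightarrow> nat" where
  "iterations rounds (Seq c c') = max (iterations rounds c) (iterations rounds c')"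
| "iterations rounds (Cond p c c') = max (iterations rounds c) (iterations rounds c')"
| "iterations rounds (Loop p c) = rounds p * iterations rounds c"
| "iterations rounds _ = 1"

lemma le_mult_iterations:
  assumes "\<And>p. 0 < rounds p"
  shows "b \<le> b * iterations rounds c"
proof -
  have "1 \<le> iterations rounds c" by (induction c) (use assms in \<open>auto simp: Suc_le_eq\<close>)
  from mult_le_mono2[OF this, of b] show ?thesis by simp
qed

lemma time_bound_le_iterations:
  assumes rounds: "\<And>p. 0 < rounds p"
  shows "time_bound rounds c \<le> time_bound (\<lambda>_. 1) c * iterations rounds c"
proof (induction c)
  case (Seq c c')
  then have "time_bound rounds c + time_bound rounds c' \<le>
      time_bound (\<lambda>_. 1) c * iterations rounds (Seq c c') +
      time_bound (\<lambda>_. 1) c' * iterations rounds (Seq c c')"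
    by (intro add_mono) (auto elim!: order_trans)
  then show ?case by (simp add: algebra_simps)
next
  case (Cond p c c')
  let ?i = "iterations rounds (Cond p c c')"
  have "bcost p + 1 \<le> (bcost p + 1) * ?i"
    using rounds by (rule le_mult_iterations)
  moreover have "time_bound rounds c \<le> time_bound (\<lambda>_. 1) c * ?i"
    "time_bound rounds c' \<le> time_bound (\<lambda>_. 1) c' * ?i"
    using Cond by (auto elim!: order_trans)
  ultimately show ?case by (simp add: algebra_simps del: iterations.simps)
next
  case (Loop p c)
  let ?b = "bcost p + 1"
  have "?b \<le> ?b * iterations rounds c"
    using rounds by (rule le_mult_iterations)
  then have "rounds p * (?b + time_bound rounds c) \<le>
      rounds p * (?b * iterations rounds c + time_bound (\<lambda>_. 1) c * iterations rounds c)"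
    using Loop by (intro mult_le_mono2 add_mono)
  moreover have "?b \<le> ?b * iterations rounds (Loop p c)"
    using rounds by (rule le_mult_iterations)
  ultimately show ?case by (simp add: algebra_simps)
qed auto

definition halts :: "(bexp \<Rightarrow> nat) \<Rightarrow> com \<Rightarrow> store \<Rightarrow> (store \<Rightarrow> bool) \<Rightarrow> bool" where
  "halts rounds c s Q \<longleftrightarrow> (\<exists>t s'. exec c s t s' \<and> t \<le> time_bound rounds c \<and> Q s')"

lemma haltsI: "exec c s t s' \<Longrightarrow> t \<le> time_bound rounds c \<Longrightarrow> Q s' \<Longrightarrow> halts rounds c s Q"
  by (auto simp: halts_def)

lemma haltsE:
  assumes "halts rounds c s Q"
  obtains t s' where "exec c s t s'" "t \<le> time_bound rounds c" "Q s'"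
  using assms by (auto simp: halts_def)

lemma halts_conseq:
  assumes "halts rounds c s Q" "\<And>s'. eq_except (written c) s s' \<Longrightarrow> Q s' \<Longrightarrow> Q' s'"
  shows "halts rounds c s Q'"
  using assms exec_eq_except unfolding halts_def by blast

lemma halts_Skip: "Q s \<Longrightarrow> halts rounds Skip s Q"
  by (rule haltsI[OF exec.Skip]) auto

lemma halts_NAssign: "Q (s\<lparr>nvar := (nvar s)(x := nval e s)\<rparr>) \<Longrightarrow> halts rounds (NAssign x e) s Q"
  by (rule haltsI[OF exec.NAssign]) auto

lemma halts_NStore:
  "Q (s\<lparr>narr := (narr s)(a := (narr s a)(nval i s := nval e s))\<rparr>) \<Longrightarrow> halts rounds (NStore a i e) s Q"
  by (rule haltsI[OF exec.NStore]) auto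

lemma halts_RAssign: "Q (s\<lparr>rvar := (rvar s)(x := rval e s)\<rparr>) \<Longrightarrow> halts rounds (RAssign x e) s Q"
  by (rule haltsI[OF exec.RAssign]) auto

lemma halts_RStore:
  "Q (s\<lparr>rarr := (rarr s)(a := (rarr s a)(nval i s := rval e s))\<rparr>) \<Longrightarrow> halts rounds (RStore a i e) s Q"
  by (rule haltsI[OF exec.RStore]) auto

lemma halts_Seq:
  assumes "halts rounds c s (\<lambda>s'. halts rounds c' s' Q)"
  shows "halts rounds (Seq c c') s Q"
  using assms by (elim haltsE) (auto intro!: haltsI exec.Seq add_mono)

lemma halts_Cond:
  assumes "bval p s \<Longrightarrow> halts rounds c s Q" "\<not> bval p s \<Longrightarrow> halts rounds c' s Q"
  shows "halts rounds (Cond p c c') s Q"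
proof (cases "bval p s")
  case True
  from assms(1)[OF this] show ?thesis
    by (elim haltsE) (rule haltsI[OF exec.CondTrue[OF True]], auto)
next
  case False
  from assms(2)[OF this] show ?thesis
    by (elim haltsE) (rule haltsI[OF exec.CondFalse[OF False]], auto)
qed

lemmas halts_intros =
  halts_Skip halts_NAssign halts_NStore halts_RAssign halts_RStore halts_Seq halts_Cond

lemma halts_Seq_conseq:
  assumes "halts rounds c s P" "\<And>s'. eq_except (written c) s s' \<Longrightarrow> P s' \<Longrightarrow> halts rounds c' s' Q"
  shows "halts rounds (Seq c c') s Q"
  by (rule halts_Seq, rule halts_conseq[OF assms])

text \<open>The index of the invariant bounds the number of iterations that remain.\<close>

lemma halts_Loop:
  assumes init: "I q s" "q \<le> rounds p"
    and exit: "\<And>s'. I 0 s' \<Longrightarrow> \<not> bval p s'"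
    and step: "\<And>q s'. I (Suc q) s' \<Longrightarrow> bval p s' \<Longrightarrow> eq_except (written c) s s' \<Longrightarrow>
      halts rounds c s' (I q)"
    and post: "\<And>q s'. I q s' \<Longrightarrow> \<not> bval p s' \<Longrightarrow> eq_except (written c) s s' \<Longrightarrow> Q s'"
  shows "halts rounds (Loop p c) s Q"
proof -
  let ?T = "bcost p + 1 + time_bound rounds c"
  have "\<exists>t s''. exec (Loop p c) s' t s'' \<and> t \<le> q * ?T + (bcost p + 1) \<and> Q s''"
    if "I q s'" "eq_except (written c) s s'" for q s'
    using that
  proof (induction q arbitrary: s')
    case 0
    then show ?case using exec.LoopFalse exit post by fastforce
  next
    case (Suc q)
    show ?case
    proof (cases "bval p s'")
      case True
      then obtain t s\<^sub>1 where body: "exec c s' t s\<^sub>1" "t \<le> time_bound rounds c" "I q s\<^sub>1"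
        using step Suc.prems by (blast elim: haltsE)
      have "eq_except (written c) s s\<^sub>1"
        using Suc.prems(2) exec_eq_except[OF body(1)] by (rule eq_except_trans)
      from Suc.IH[OF body(3) this] obtain t' s\<^sub>2 where
        rest: "exec (Loop p c) s\<^sub>1 t' s\<^sub>2" "t' \<le> q * ?T + (bcost p + 1)" "Q s\<^sub>2"
        by blast
      have "bcost p + 1 + t + t' \<le> Suc q * ?T + (bcost p + 1)" using body(2) rest(2) by simp
      then show ?thesis using exec.LoopTrue[OF True body(1) rest(1)] rest(3) by blast
    next
      case False
      then show ?thesis using exec.LoopFalse post[OF Suc.prems(1)] Suc.prems(2) by fastforce
    qed
  qed
  from this[OF init(1) eq_except_refl] obtain t s' where
    run: "exec (Loop p c) s t s'" "t \<le> q * ?T + (bcost p + 1)" "Q s'" by blast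
  have "q * ?T \<le> rounds p * ?T" using init(2) by (rule mult_le_mono1)
  then show ?thesis using run by (auto intro: haltsI)
qed

abbreviation sequential :: "com \<Rightarrow> com \<Rightarrow> com" (infixr ";;" 60) where
  "c ;; c' \<equiv> Seq c c'"

abbreviation When :: "bexp \<Rightarrow> com \<Rightarrow> com" where
  "When p c \<equiv> Cond p c Skip"

abbreviation NLe :: "nexp \<Rightarrow> nexp \<Rightarrow> bexp" where
  "NLe e f \<equiv> BNot (NLess f e)"

abbreviation RLe :: "rexp \<Rightarrow> rexp \<Rightarrow> bexp" where
  "RLe e f \<equiv> BNot (RLess f e)"

abbreviation Incr :: "vname \<Rightarrow> com" where
  "Incr x \<equiv> NAssign x (NPlus (NVar x) (NConst 1))"

definition For :: "vname \<Rightarrow> vname \<Rightarrow> com \<Rightarrow> com" where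
  "For i l c = NAssign i (NConst 0) ;; Loop (NLess (NVar i) (NVar l)) (c ;; Incr i)"

lemma written_For [simp]: "written (For i l c) = insert (NatVar i) (written c)"
  by (auto simp: For_def)

lemma iterations_For [simp]:
  "iterations rounds (For i l c) =
    max 1 (rounds (NLess (NVar i) (NVar l)) * max 1 (iterations rounds c))"
  by (simp add: For_def max.commute)

abbreviation set_nvar :: "vname \<Rightarrow> nat \<Rightarrow> store \<Rightarrow> store" where
  "set_nvar x v s \<equiv> s\<lparr>nvar := (nvar s)(x := v)\<rparr>"

lemma eq_except_set_nvar:
  "eq_except W (set_nvar x v s) s' \<Longrightarrow> eq_except (insert (NatVar x) W) s s'"
  by (auto simp: eq_except_def)

lemma halts_For:
  assumes bound: "nvar s l = N" "N \<le> rounds (NLess (NVar i) (NVar l))"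
    and fresh: "l \<noteq> i" "NatVar l \<notin> written c" "NatVar i \<notin> written c"
    and indep: "\<And>j v s. I j (set_nvar i v s) \<longleftrightarrow> I j s"
    and init: "I 0 s"
    and step: "\<And>j s'. j < N \<Longrightarrow> nvar s' i = j \<Longrightarrow> I j s' \<Longrightarrow>
      eq_except (written (For i l c)) s s' \<Longrightarrow> halts rounds c s' (I (Suc j))"
    and post: "\<And>s'. I N s' \<Longrightarrow> eq_except (written (For i l c)) s s' \<Longrightarrow> Q s'"
  shows "halts rounds (For i l c) s Q"
proof -
  let ?s = "set_nvar i 0 s" and ?c = "c ;; Incr i"
  define J where "J q s' \<longleftrightarrow> q \<le> N \<and> nvar s' i = N - q \<and> I (N - q) s'" for q s'
  have frame: "eq_except (written (For i l c)) s s'" if "eq_except (written ?c) ?s s'" for s'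
    using that by (auto simp: eq_except_def)
  have "halts rounds (Loop (NLess (NVar i) (NVar l)) ?c) ?s Q"
  proof (rule halts_Loop[where I = "\<lambda>q s'. J q s' \<and> nvar s' l = N" and q = N])
    fix q s' assume inv: "J (Suc q) s' \<and> nvar s' l = N" and "eq_except (written ?c) ?s s'"
    then have "halts rounds c s' (I (N - q))"
      using step[of "N - Suc q" s'] frame by (auto simp: J_def Suc_diff_Suc)
    then show "halts rounds ?c s' (\<lambda>s'. J q s' \<and> nvar s' l = N)"
    proof (rule halts_Seq_conseq)
      fix s'' assume next_inv: "I (N - q) s''" and "eq_except (written c) s' s''"
      then have "nvar s'' i = N - Suc q" "nvar s'' l = N"
        using inv eq_exceptD(1)[of "written c" s' s''] fresh by (simp_all add: J_def)
      then show "halts rounds (Incr i) s'' (\<lambda>s'. J q s' \<and> nvar s' l = N)"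
        using next_inv inv indep fresh by (intro halts_intros) (auto simp: J_def Suc_diff_Suc)
    qed
  next
    fix q s' assume inv: "J q s' \<and> nvar s' l = N" and "\<not> bval (NLess (NVar i) (NVar l)) s'"
      and agree: "eq_except (written ?c) ?s s'"
    then have "N - q = N" by (simp add: J_def)
    then show "Q s'" using inv post frame[OF agree] by (simp add: J_def)
  qed (use bound fresh init indep in \<open>auto simp: J_def\<close>)
  then show ?thesis unfolding For_def by (intro halts_Seq halts_NAssign) simp_all
qed

section \<open>Selection of the centers\<close>

definition heaviest_subset :: "('a \<Rightarrow> 'b::linorder) \<Rightarrow> 'a set \<Rightarrow> 'a set \<Rightarrow> bool" where
  "heaviest_subset w R E \<longleftrightarrow> E \<subseteq> R \<and> (\<forall>x\<in>E. \<forall>y\<in>R - E. w y \<le> w x)"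

lemma heaviest_subset_empty: "heaviest_subset w R {}"
  by (simp add: heaviest_subset_def)

lemma heaviest_subset_insert:
  assumes "heaviest_subset w R E" "is_arg_max w (\<lambda>x. x \<in> R - E) c"
  shows "heaviest_subset w R (insert c E)"
  using assms unfolding heaviest_subset_def is_arg_max_linorder by auto

lemma sum_le_sum_heaviest_subset:
  fixes w :: "'a \<Rightarrow> 'b :: {linorder, ordered_comm_monoid_add}"
  assumes "finite R" and nonneg: "\<And>x. x \<in> R \<Longrightarrow> 0 \<le> w x"
    and heaviest: "heaviest_subset w R E" and F_bounds: "F \<subseteq> R" "card F \<le> card E"
  shows "sum w F \<le> sum w E"
proof -
  have E_sub: "E \<subseteq> R" using heaviest by (simp add: heaviest_subset_def)
  have fin: "finite E" "finite F" using \<open>finite R\<close> E_sub F_bounds(1) finite_subset by blast+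
  have "card (F - E) \<le> card (E - F)"
    using F_bounds(2) fin card_Int_Diff[of F E] card_Int_Diff[of E F] by (simp add: Int_commute)
  then obtain g where injection: "g ` (F - E) \<subseteq> E - F" "inj_on g (F - E)"
    using fin card_le_inj[of "F - E" "E - F"] by blast
  have "sum w (F - E) \<le> (\<Sum>x\<in>F - E. w (g x))"
    using injection(1) heaviest F_bounds(1) unfolding heaviest_subset_def by (intro sum_mono) blast
  also have "\<dots> = sum w (g ` (F - E))" using injection(2) by (simp add: sum.reindex)
  also have "\<dots> \<le> sum w (E - F)"
    using injection(1) fin E_sub nonneg by (intro sum_mono2) auto
  finally have "sum w (F \<inter> E) + sum w (F - E) \<le> sum w (E \<inter> F) + sum w (E - F)"
    by (simp add: Int_commute add_left_mono)
  then show ?thesis using fin by (simp flip: sum.Int_Diff)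
qed

definition heaviest_or_default :: "('a \<Rightarrow> 'b::linorder) \<Rightarrow> 'a set \<Rightarrow> 'a \<Rightarrow> 'a \<Rightarrow> bool" where
  "heaviest_or_default w A z c \<longleftrightarrow> (if A = {} then c = z else is_arg_max w (\<lambda>x. x \<in> A) c)"

lemma heaviest_or_default_cong:
  assumes "\<And>x. x \<in> A \<Longrightarrow> w x = w' x"
  shows "heaviest_or_default w A z c \<longleftrightarrow> heaviest_or_default w' A z c"
  using assms by (auto simp: heaviest_or_default_def is_arg_max_linorder)

lemma heaviest_or_default_insert:
  assumes "heaviest_or_default w A z c"
  shows "heaviest_or_default w (insert x A) z (if A = {} \<or> w c \<le> w x then x else c)"
  using assms by (force simp: heaviest_or_default_def is_arg_max_linorder split: if_splits)

context Metric_space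
begin

definition separated :: "real \<Rightarrow> 'a set \<Rightarrow> bool" where
  "separated r S \<longleftrightarrow> S \<subseteq> M \<and> (\<forall>s\<in>S. \<forall>t\<in>S. s \<noteq> t \<longrightarrow> 2 * r < d s t)"

lemma separated_inj_on:
  assumes sep: "separated r S" and near: "\<And>s. s \<in> S \<Longrightarrow> f s \<in> M \<and> d s (f s) \<le> r"
  shows "inj_on f S"
proof (rule inj_onI, rule ccontr)
  fix s t assume s_t: "s \<in> S" "t \<in> S" "f s = f t" "s \<noteq> t"
  have "d s t \<le> d s (f s) + d (f s) t"
    using s_t sep near by (intro triangle) (auto simp: separated_def)
  also have "\<dots> \<le> r + r" using near[OF s_t(1)] near[OF s_t(2)] s_t(3) commute[of "f s" t] by simp
  finally show False using sep s_t unfolding separated_def by force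
qed

definition net :: "real \<Rightarrow> 'a set \<Rightarrow> ('a \<Rightarrow> 'a) \<Rightarrow> bool" where
  "net r S rep \<longleftrightarrow> separated r S \<and> (\<forall>x\<in>M. rep x \<in> S \<and> d (rep x) x \<le> 2 * r)"

definition partial_net :: "real \<Rightarrow> 'a set \<Rightarrow> 'a set \<Rightarrow> ('a \<Rightarrow> 'a) \<Rightarrow> bool" where
  "partial_net r S U rep \<longleftrightarrow> separated r S \<and> S \<subseteq> U \<and>
     (\<forall>x\<in>U. rep x \<in> S \<and> d (rep x) x \<le> 2 * r) \<and> (\<forall>x\<in>M - U. \<forall>s\<in>S. 2 * r < d s x)"

lemma partial_net_empty: "partial_net r {} {} rep"
  by (simp add: partial_net_def separated_def)

lemma partial_net_insert:
  assumes net: "partial_net r S U rep" and uncovered: "x \<in> M - U" and "0 \<le> r"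
    and rep': "\<And>y. y \<in> U \<Longrightarrow> rep' y = rep y" "\<And>y. y \<in> M - U \<Longrightarrow> d x y \<le> 2 * r \<Longrightarrow> rep' y = x"
  shows "partial_net r (insert x S) (U \<union> {y \<in> M. d x y \<le> 2 * r}) rep'"
proof -
  have "2 * r < d s x \<and> 2 * r < d x s" if "s \<in> S" for s
    using net uncovered that commute[of x s] by (auto simp: partial_net_def)
  then have "separated r (insert x S)"
    using net uncovered by (auto simp: partial_net_def separated_def)
  moreover have "d x x \<le> 2 * r" using uncovered \<open>0 \<le> r\<close> by simp
  moreover have "rep' y \<in> insert x S \<and> d (rep' y) y \<le> 2 * r"
    if "y \<in> U \<union> {y \<in> M. d x y \<le> 2 * r}" for y
    using that net rep' by (cases "y \<in> U") (auto simp: partial_net_def)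
  ultimately show ?thesis using net uncovered by (auto simp: partial_net_def)
qed

lemma net_if_partial_net: "partial_net r S M rep \<Longrightarrow> net r S rep"
  by (simp add: partial_net_def net_def)

end

locale label_consistent =
  fixes X :: "'a set" and d :: "'a \<Rightarrow> 'a \<Rightarrow> real" and k b :: nat and \<H> :: "'a clustering"
  assumes lc_instance: "lc_instance X d k b \<H>"
begin

sublocale Metric_space X d
  using lc_instance by (simp add: lc_instance_def)

lemma finite_X: "finite X"
  and \<H>_subset: "fst \<H> \<subseteq> X" and card_\<H>: "card (fst \<H>) = k"
  and label_in_\<H>: "x \<in> X \<Longrightarrow> snd \<H> x \<in> fst \<H>"
  using lc_instance by (auto simp: lc_instance_def is_clustering_def)

lemma label_in_X: "x \<in> X \<Longrightarrow> snd \<H> x \<in> X"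
  using label_in_\<H> \<H>_subset by blast

lemma finite_\<H>: "finite (fst \<H>)"
  using \<H>_subset finite_X by (rule finite_subset)

lemma k_le_card_X: "k \<le> card X"
  using card_mono[OF finite_X \<H>_subset] card_\<H> by simp

lemma X_nonempty: "X \<noteq> {}"
  using lc_instance by (auto simp: lc_instance_def is_clustering_def)

lemma cost_inf_le_iff: "cost_inf X d \<C> \<le> r \<longleftrightarrow> (\<forall>x\<in>X. d x (snd \<C> x) \<le> r)"
  unfolding cost_inf_def using finite_X X_nonempty by (subst Max_le_iff) auto

lemma lc_opt_is_distance: "lc_opt X d k b \<H> \<in> (\<lambda>(x, y). d x y) ` (X \<times> X)"
proof -
  obtain \<C> where optimal: "is_clustering X k \<C>" "cost_inf X d \<C> = lc_opt X d k b \<H>"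
    using lc_opt_attained(1)[OF lc_instance] by (auto simp: lc_feasible_def)
  have "cost_inf X d \<C> \<in> (\<lambda>x. d x (snd \<C> x)) ` X"
    unfolding cost_inf_def using finite_X X_nonempty by (intro Max_in) auto
  then show ?thesis using optimal by (force simp: is_clustering_def)
qed

lemma finite_separated: "separated r S \<Longrightarrow> finite S"
  using finite_X finite_subset by (auto simp: separated_def)

lemma card_separated_le:
  assumes "separated r S" "is_clustering X k \<C>" "cost_inf X d \<C> \<le> r"
  shows "card S \<le> k"
proof -
  have "S \<subseteq> X" "fst \<C> \<subseteq> X" and label: "\<And>x. x \<in> X \<Longrightarrow> snd \<C> x \<in> fst \<C>" and "card (fst \<C>) = k"
    using assms(1,2) by (auto simp: separated_def is_clustering_def)
  moreover have "inj_on (snd \<C>) S"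
    using calculation assms(3) by (intro separated_inj_on[OF assms(1)]) (auto simp: cost_inf_le_iff)
  ultimately show ?thesis
    using card_inj_on_le[of "snd \<C>" S "fst \<C>"] finite_X finite_subset by blast
qed

definition retained :: "real \<Rightarrow> 'a set \<Rightarrow> 'a set" where
  "retained r C = {x \<in> X. snd \<H> x \<in> C \<and> d x (snd \<H> x) \<le> r}"

lemma retained_subset: "retained r C \<subseteq> X"
  by (auto simp: retained_def)

lemma finite_retained: "finite (retained r C)"
  using retained_subset finite_X by (rule finite_subset)

definition weight :: "real \<Rightarrow> 'a \<Rightarrow> nat" where
  "weight r h = card {x \<in> X. snd \<H> x = h \<and> d x h \<le> r}"

lemma sum_weight:
  assumes "finite C"
  shows "sum (weight r) C = card (retained r C)"
proof -
  have "retained r C = (\<Union>h\<in>C. {x \<in> X. snd \<H> x = h \<and> d x h \<le> r})"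
    by (auto simp: retained_def)
  also have "card \<dots> = sum (weight r) C"
    unfolding weight_def by (rule card_UN_disjoint) (use assms finite_X in auto)
  finally show ?thesis by simp
qed

lemma weight_eq_0: "h \<notin> fst \<H> \<Longrightarrow> weight r h = 0"
  using label_in_\<H> by (auto simp: weight_def card_eq_0_iff)

definition best_center :: "real \<Rightarrow> 'a \<Rightarrow> 'a \<Rightarrow> bool" where
  "best_center r s c \<longleftrightarrow> heaviest_or_default (weight r) {h \<in> fst \<H>. d s h \<le> r} s c"

lemma best_center_near:
  assumes "best_center r s c" "s \<in> X" "0 \<le> r"
  shows "c \<in> X" "d s c \<le> r"
  using assms \<H>_subset
  by (auto simp: best_center_def heaviest_or_default_def is_arg_max_linorder split: if_splits)

lemma weight_le_best_center:
  assumes "best_center r s c" "d s h \<le> r"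
  shows "weight r h \<le> weight r c"
proof (cases "h \<in> fst \<H>")
  case True
  then show ?thesis using assms
    by (auto simp: best_center_def heaviest_or_default_def is_arg_max_linorder split: if_splits)
qed (simp add: weight_eq_0)

lemma best_centers_of_separated_near:
  assumes "separated r S" "s \<in> S" "best_center r s c" "0 \<le> r"
  shows "c \<in> X \<and> d s c \<le> r"
  using assms best_center_near[of r s c] by (auto simp: separated_def)

definition selection :: "real \<Rightarrow> 'a set \<Rightarrow> ('a \<Rightarrow> 'a) \<Rightarrow> 'a set \<Rightarrow> bool" where
  "selection r S cen C \<longleftrightarrow> (\<forall>s\<in>S. best_center r s (cen s)) \<and>
     (\<exists>E. heaviest_subset (weight r) (fst \<H> - cen ` S) E \<and> card E = k - card S \<and> C = cen ` S \<union> E)"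

text \<open>
  The exchange argument: the competing center \<open>snd \<C> s\<close> of \<open>s \<in> S\<close> is traded for \<open>cen s\<close>, unless
  \<open>cen s\<close> is itself a competing center.
\<close>

lemma competing_centers_of_separated:
  assumes r_nonneg: "0 \<le> r" and sep: "separated r S" and best: "\<And>s. s \<in> S \<Longrightarrow> best_center r s (cen s)"
    and competitor: "is_clustering X k \<C>" "cost_inf X d \<C> \<le> r"
  obtains M where "M \<subseteq> fst \<C>" "card M = card S" "cen ` S \<inter> fst \<C> \<subseteq> M"
    "sum (weight r) M \<le> sum (weight r) (cen ` S)"
proof -
  define match where "match s = (if cen s \<in> fst \<C> then cen s else snd \<C> s)" for s
  have S_subset: "S \<subseteq> X" using sep by (simp add: separated_def)
  have cen_near: "cen s \<in> X \<and> d s (cen s) \<le> r" if "s \<in> S" for s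
    using sep that best[OF that] r_nonneg by (rule best_centers_of_separated_near)
  have match_near: "match s \<in> fst \<C> \<and> d s (match s) \<le> r" if "s \<in> S" for s
    using that S_subset competitor cen_near
    by (auto simp: match_def is_clustering_def cost_inf_le_iff)
  have inj_cen: "inj_on cen S" using cen_near by (rule separated_inj_on[OF sep])
  have inj_match: "inj_on match S"
    using match_near competitor(1)
    by (intro separated_inj_on[OF sep]) (auto simp: is_clustering_def)
  show thesis
  proof
    show "match ` S \<subseteq> fst \<C>" using match_near by blast
    show "card (match ` S) = card S" using inj_match by (rule card_image)
    show "cen ` S \<inter> fst \<C> \<subseteq> match ` S" by (force simp: match_def)
    show "sum (weight r) (match ` S) \<le> sum (weight r) (cen ` S)"
      using inj_match inj_cen match_near weight_le_best_center[OF best]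
      by (simp add: sum.reindex sum_mono)
  qed
qed

lemma sum_weight_le_selection:
  assumes r_nonneg: "0 \<le> r" and sep: "separated r S" and sel: "selection r S cen C"
    and competitor: "is_clustering X k \<C>" "cost_inf X d \<C> \<le> r"
  shows "sum (weight r) (fst \<C>) \<le> sum (weight r) C"
proof -
  let ?w = "weight r" and ?C' = "fst \<C>"
  from sel obtain E where best: "\<And>s. s \<in> S \<Longrightarrow> best_center r s (cen s)"
    and heaviest: "heaviest_subset ?w (fst \<H> - cen ` S) E" "card E = k - card S"
    and C_eq: "C = cen ` S \<union> E"
    by (auto simp: selection_def)
  obtain M where M_bounds: "M \<subseteq> ?C'" "card M = card S" "cen ` S \<inter> ?C' \<subseteq> M"
    and traded: "sum ?w M \<le> sum ?w (cen ` S)"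
    using competing_centers_of_separated[OF r_nonneg sep best competitor] .
  have card_C': "card ?C' = k" "finite ?C'"
    using competitor(1) finite_X finite_subset by (auto simp: is_clustering_def)
  have "card (?C' - M) = card E"
    using M_bounds(1,2) card_C' heaviest(2) by (simp add: card_Diff_subset finite_subset)
  then have "card ((?C' - M) \<inter> fst \<H>) \<le> card E"
    using card_C'(2) by (metis card_mono finite_Diff inf_le1)
  then have others: "sum ?w ((?C' - M) \<inter> fst \<H>) \<le> sum ?w E"
    using heaviest(1) M_bounds(3) finite_\<H> by (intro sum_le_sum_heaviest_subset) auto
  have "sum ?w ?C' = sum ?w M + sum ?w (?C' - M)"
    using M_bounds(1) card_C'(2) by (subst sum.subset_diff[of M]) auto
  also have "sum ?w (?C' - M) = sum ?w ((?C' - M) \<inter> fst \<H>)"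
    using card_C'(2) by (intro sum.mono_neutral_right ballI weight_eq_0) auto
  also have "sum ?w M + \<dots> \<le> sum ?w (cen ` S) + sum ?w E"
    using traded others by (rule add_mono)
  also have "\<dots> = sum ?w C"
    unfolding C_eq using heaviest(1) finite_separated[OF sep] finite_\<H>
    by (intro sum.union_disjoint[symmetric]) (auto simp: heaviest_subset_def intro: finite_subset)
  finally show ?thesis .
qed

lemma
  assumes r_nonneg: "0 \<le> r" and sep: "separated r S" and sel: "selection r S cen C"
  shows selection_subset: "C \<subseteq> X"
    and selection_card: "card S \<le> k \<Longrightarrow> card C = k"
    and selection_cen: "s \<in> S \<Longrightarrow> cen s \<in> C \<and> d s (cen s) \<le> r"
proof -
  from sel obtain E where best: "\<And>s. s \<in> S \<Longrightarrow> best_center r s (cen s)"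
    and E_bounds: "E \<subseteq> fst \<H> - cen ` S" "card E = k - card S" and C_eq: "C = cen ` S \<union> E"
    by (auto simp: selection_def heaviest_subset_def)
  have cen_near: "cen s \<in> X \<and> d s (cen s) \<le> r" if "s \<in> S" for s
    using sep that best[OF that] r_nonneg by (rule best_centers_of_separated_near)
  show "C \<subseteq> X" using C_eq cen_near E_bounds \<H>_subset by auto
  show "s \<in> S \<Longrightarrow> cen s \<in> C \<and> d s (cen s) \<le> r" using C_eq cen_near by simp
  have "card C = card (cen ` S) + card E"
    unfolding C_eq using E_bounds finite_separated[OF sep] finite_\<H>
    by (intro card_Un_disjoint) (auto intro: finite_subset)
  then show "card S \<le> k \<Longrightarrow> card C = k"
    using separated_inj_on[OF sep cen_near] E_bounds(2) by (simp add: card_image)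
qed

lemma selection_sound:
  assumes r_nonneg: "0 \<le> r" and net: "net r S rep" and sel: "selection r S cen C"
    and labels: "\<And>x. x \<in> X \<Longrightarrow> l x = (if x \<in> retained r C then snd \<H> x else cen (rep x))"
    and accept: "card S \<le> k" "card (X - retained r C) \<le> b"
  shows "lc_feasible X k b \<H> (C, l)" "cost_inf X d (C, l) \<le> 3 * r"
proof -
  have sep: "separated r S" and rep_near: "\<And>x. x \<in> X \<Longrightarrow> rep x \<in> S \<and> d (rep x) x \<le> 2 * r"
    using net by (auto simp: net_def)
  note subset = selection_subset[OF r_nonneg sep sel] and card = selection_card[OF r_nonneg sep sel]
    and cen = selection_cen[OF r_nonneg sep sel]
  have "label_diff X \<H> (C, l) \<le> card (X - retained r C)"
    unfolding label_diff_def using labels finite_X by (intro card_mono) auto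
  moreover have "l x \<in> C" if "x \<in> X" for x
    using labels[OF that] rep_near[OF that] cen by (auto simp: retained_def)
  ultimately show "lc_feasible X k b \<H> (C, l)"
    using subset card accept by (auto simp: lc_feasible_def is_clustering_def)
  have "d x (l x) \<le> 3 * r" if x_in: "x \<in> X" for x
  proof (cases "x \<in> retained r C")
    case True
    then show ?thesis using labels[OF x_in] r_nonneg by (simp add: retained_def)
  next
    case False
    have "d x (cen (rep x)) \<le> d x (rep x) + d (rep x) (cen (rep x))"
      using x_in rep_near[OF x_in] sep subset cen by (intro triangle) (auto simp: separated_def)
    also have "\<dots> \<le> 2 * r + r"
      using rep_near[OF x_in] cen commute[of x "rep x"] by (intro add_mono) auto
    finally show ?thesis using labels[OF x_in] False by simp
  qed
  then show "cost_inf X d (C, l) \<le> 3 * r" by (simp add: cost_inf_le_iff)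
qed

lemma selection_complete:
  assumes r_nonneg: "0 \<le> r" and sep: "separated r S" and sel: "selection r S cen C"
    and opt: "lc_opt X d k b \<H> \<le> r"
  shows "card S \<le> k \<and> card (X - retained r C) \<le> b"
proof -
  obtain \<C> where competitor: "is_clustering X k \<C>" "label_diff X \<H> \<C> \<le> b" "cost_inf X d \<C> \<le> r"
    using lc_opt_attained(1)[OF lc_instance] opt by (auto simp: lc_feasible_def)
  have "finite (fst \<C>)" "finite C"
    using competitor(1) selection_subset[OF r_nonneg sep sel] finite_X finite_subset
    by (auto simp: is_clustering_def)
  then have "card (retained r (fst \<C>)) \<le> card (retained r C)"
    using sum_weight_le_selection[OF r_nonneg sep sel competitor(1,3)] by (simp add: sum_weight)
  then have "card (X - retained r C) \<le> card (X - retained r (fst \<C>))"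
    using finite_X by (simp add: card_Diff_subset finite_retained retained_subset diff_le_mono2)
  also have "\<dots> \<le> label_diff X \<H> \<C>"
    unfolding label_diff_def using competitor(1,3) finite_X
    by (intro card_mono) (auto simp: retained_def is_clustering_def cost_inf_le_iff)
  finally have "card (X - retained r C) \<le> b" using competitor(2) by simp
  then show ?thesis using card_separated_le[OF sep competitor(1,3)] by simp
qed

end

section \<open>Merge sort\<close>

definition block_sorted :: "nat \<Rightarrow> (nat \<Rightarrow> 'a::preorder) \<Rightarrow> nat \<Rightarrow> bool" where
  "block_sorted w A N \<longleftrightarrow> (\<forall>a. w dvd a \<longrightarrow> mono_on {a..<min N (a + w)} A)"

lemma block_sorted_Suc_0: "block_sorted (Suc 0) A N"
  by (auto simp: block_sorted_def monotone_on_def le_less_Suc_eq)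

lemma mono_on_if_block_sorted:
  assumes "block_sorted w A N" "N \<le> w"
  shows "mono_on {..<N} A"
  using assms(1)[unfolded block_sorted_def, rule_format, of 0] assms(2)
  by (simp add: lessThan_atLeast0)

lemma block_sorted_cong: "(\<And>i. i < N \<Longrightarrow> A i = B i) \<Longrightarrow> block_sorted w A N \<longleftrightarrow> block_sorted w B N"
  by (auto simp: block_sorted_def monotone_on_def)

lemma block_sorted_append_block:
  assumes "block_sorted w A a" "mono_on {a..<e} A" "w dvd a" "e \<le> a + w"
  shows "block_sorted w A e"
  unfolding block_sorted_def
proof (intro allI impI)
  fix a' assume block_start: "w dvd a'"
  show "mono_on {a'..<min e (a' + w)} A"
  proof (cases "a \<le> a'")
    case True
    then show ?thesis by (intro mono_on_subset[OF assms(2)]) auto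
  next
    case False
    then have "a' + w \<le> a" using block_start assms(3) dvd_imp_le[of w "a - a'"] by simp
    moreover have "mono_on {a'..<min a (a' + w)} A"
      using assms(1) block_start unfolding block_sorted_def by blast
    ultimately show ?thesis by (auto intro: mono_on_subset)
  qed
qed

definition sorted_listing ::
  "(nat \<Rightarrow> 'a::preorder) \<Rightarrow> nat set \<Rightarrow> nat set \<Rightarrow> (nat \<Rightarrow> 'a) \<Rightarrow> nat \<Rightarrow> nat \<Rightarrow> bool" where
  "sorted_listing A D R B a p \<longleftrightarrow>
     mono_on {a..<p} B \<and> B ` {a..<p} = A ` D \<and> (\<forall>x\<in>{a..<p}. \<forall>q\<in>R. B x \<le> A q)"

lemma sorted_listing_append:
  assumes list: "sorted_listing A D R B a p" and least: "q \<in> R" "\<And>q'. q' \<in> R' \<Longrightarrow> A q \<le> A q'"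
    and rest: "R' \<subseteq> R" and listed: "D' = insert q D" and "a \<le> p"
  shows "sorted_listing A D' R' (B(p := A q)) a (Suc p)"
proof -
  let ?B = "B(p := A q)"
  have upto: "{a..<Suc p} = insert p {a..<p}" using \<open>a \<le> p\<close> by auto
  have "?B ` {a..<p} = B ` {a..<p}" by (intro image_cong) auto
  then have "?B ` {a..<Suc p} = insert (A q) (B ` {a..<p})"
    unfolding upto by (simp only: image_insert fun_upd_same)
  then have "?B ` {a..<Suc p} = A ` D'" using list listed by (simp add: sorted_listing_def)
  moreover have "mono_on {a..<Suc p} ?B"
    using list least(1) by (auto simp: sorted_listing_def monotone_on_def less_Suc_eq)
  ultimately show ?thesis
    using list least(2) rest by (auto simp: sorted_listing_def less_Suc_eq)
qed

definition merged :: "nat \<Rightarrow> (nat \<Rightarrow> 'a::preorder) \<Rightarrow> (nat \<Rightarrow> 'a) \<Rightarrow> nat \<Rightarrow> bool" where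
  "merged w A B p \<longleftrightarrow> block_sorted (2 * w) B p \<and> B ` {..<p} = A ` {..<p}"

lemma merged_cong:
  assumes "\<And>i. i < p \<Longrightarrow> B i = B' i"
  shows "merged w A B p \<longleftrightarrow> merged w A B' p"
  using assms block_sorted_cong[of p B B'] image_cong[of "{..<p}" "{..<p}" B B']
  by (simp add: merged_def)

text \<open>
  A merge pass that has written \<open>B\<close> up to \<open>p\<close> is merging the runs \<open>{a..<u}\<close> and \<open>{u..<e}\<close> of \<open>A\<close>;
  the elements before \<open>i\<close> and \<open>j\<close>, respectively, have been consumed.
\<close>

definition merging ::
  "nat \<Rightarrow> nat \<Rightarrow> (nat \<Rightarrow> 'a::preorder) \<Rightarrow> (nat \<Rightarrow> 'a) \<Rightarrow> nat \<Rightarrow> nat \<Rightarrow> nat \<Rightarrow> nat \<Rightarrow> nat \<Rightarrow> nat \<Rightarrow> bool" where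
  "merging N w A B a i u j e p \<longleftrightarrow>
     2 * w dvd a \<and> u = min N (a + w) \<and> e = min N (u + w) \<and>
     a \<le> i \<and> i \<le> u \<and> u \<le> j \<and> j \<le> e \<and> p + u = i + j \<and>
     merged w A B a \<and>
     sorted_listing A ({a..<i} \<union> {u..<j}) ({i..<u} \<union> {j..<e}) B a p"

lemma merging_start:
  assumes "merged w A B a" "2 * w dvd a" "a < N"
  shows "merging N w A B a a (min N (a + w)) (min N (a + w)) (min N (min N (a + w) + w)) a"
  using assms by (auto simp: merging_def sorted_listing_def intro!: mono_onI)

lemma mergingD:
  assumes "merging N w A B a i u j e p"
  shows "a \<le> i" "i \<le> u" "u \<le> j" "j \<le> e" "e \<le> N" "p + u = i + j" "merged w A B a"
    "sorted_listing A ({a..<i} \<union> {u..<j}) ({i..<u} \<union> {j..<e}) B a p"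
  using assms unfolding merging_def by auto

lemma merging_mono_on_runs:
  assumes "merging N w A B a i u j e p" "block_sorted w A N"
  shows "mono_on {a..<u} A" "mono_on {u..<e} A"
proof -
  have u_eq: "u = min N (a + w)" and e_eq: "e = min N (u + w)" and "w dvd a"
    using assms(1) dvd_mult_right[of 2 w a] unfolding merging_def by blast+
  then show "mono_on {a..<u} A"
    using assms(2) by (simp add: block_sorted_def)
  have "mono_on {a + w..<min N (a + w + w)} A"
    using assms(2) \<open>w dvd a\<close> by (simp add: block_sorted_def)
  then show "mono_on {u..<e} A"
    unfolding e_eq u_eq by (rule mono_on_subset) auto
qed

lemma merging_advance:
  assumes merging: "merging N w A B a i u j e p"
    and "i \<le> i'" "i' \<le> u" "j \<le> j'" "j' \<le> e" "Suc p + u = i' + j'"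
    and "sorted_listing A ({a..<i'} \<union> {u..<j'}) ({i'..<u} \<union> {j'..<e}) (B(p := x)) a (Suc p)"
  shows "merging N w A (B(p := x)) a i' u j' e (Suc p)"
proof -
  note state = mergingD[OF merging]
  have "merged w A (B(p := x)) a \<longleftrightarrow> merged w A B a" using state by (intro merged_cong) auto
  moreover have "a \<le> i'" "u \<le> j'" using state assms(2,4) by linarith+
  ultimately show ?thesis using merging assms(2-) unfolding merging_def by blast
qed

lemma merging_least:
  assumes merging: "merging N w A B a i u j e p" and blocks: "block_sorted w A N"
    and lower: "i < u \<Longrightarrow> x \<le> A i" "j < e \<Longrightarrow> x \<le> A j" and q_in: "q \<in> {i..<u} \<union> {j..<e}"
  shows "x \<le> A q"
proof -
  note runs = merging_mono_on_runs[OF merging blocks]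
  from q_in show ?thesis
  proof
    assume "q \<in> {i..<u}"
    then have "x \<le> A i" "A i \<le> A q"
      using lower(1) mergingD[OF merging] by (auto intro: mono_onD[OF runs(1)])
    then show ?thesis by (rule order_trans)
  next
    assume "q \<in> {j..<e}"
    then have "x \<le> A j" "A j \<le> A q"
      using lower(2) mergingD[OF merging] by (auto intro: mono_onD[OF runs(2)])
    then show ?thesis by (rule order_trans)
  qed
qed

lemma merging_left:
  assumes merging: "merging N w A B a i u j e p" and blocks: "block_sorted w A N"
    and take_left: "i < u" "j < e \<Longrightarrow> A i \<le> A j"
  shows "merging N w A (B(p := A i)) a (Suc i) u j e (Suc p)"
proof -
  note state = mergingD[OF merging]
  have "sorted_listing A ({a..<Suc i} \<union> {u..<j}) ({Suc i..<u} \<union> {j..<e}) (B(p := A i)) a (Suc p)"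
    by (rule sorted_listing_append[OF state(8) _ merging_least[OF merging blocks]])
      (use state take_left in auto)
  then show ?thesis using state take_left(1) by (intro merging_advance[OF merging]) auto
qed

lemma merging_right:
  assumes merging: "merging N w A B a i u j e p" and blocks: "block_sorted w A N"
    and take_right: "j < e" "i < u \<Longrightarrow> A j \<le> A i"
  shows "merging N w A (B(p := A j)) a i u (Suc j) e (Suc p)"
proof -
  note state = mergingD[OF merging]
  have "sorted_listing A ({a..<i} \<union> {u..<Suc j}) ({i..<u} \<union> {Suc j..<e}) (B(p := A j)) a (Suc p)"
    by (rule sorted_listing_append[OF state(8) _ merging_least[OF merging blocks]])
      (use state take_right in auto)
  then show ?thesis using state take_right(1) by (intro merging_advance[OF merging]) auto
qed

lemma merging_finish:
  assumes merging: "merging N w A B a i u j e e"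
  shows "merged w A B e" "e < N \<Longrightarrow> 2 * w dvd e"
proof -
  note state = mergingD[OF merging]
  have consumed: "i = u" "j = e" using state by linarith+
  have parts: "{..<e} = {..<a} \<union> {a..<e}" "{a..<u} \<union> {u..<e} = {a..<e}" using state by auto
  have block: "B ` {a..<e} = A ` {a..<e}" "mono_on {a..<e} B"
    using state(8) unfolding sorted_listing_def consumed parts(2) by blast+
  have "B ` {..<e} = A ` {..<e}"
    unfolding parts(1) image_Un using block(1) state(7) by (simp add: merged_def)
  moreover have "2 * w dvd a" "e \<le> a + 2 * w" using merging by (auto simp: merging_def)
  then have "block_sorted (2 * w) B e"
    using state(7) by (intro block_sorted_append_block[OF _ block(2)]) (auto simp: merged_def)
  ultimately show "merged w A B e" by (simp add: merged_def)
  assume "e < N"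
  then have "e = a + 2 * w" using merging unfolding merging_def by (elim conjE) linarith
  then show "2 * w dvd e" using \<open>2 * w dvd a\<close> by simp
qed

definition next_runs_com :: com where
  "next_runs_com =
     NAssign ''left'' (NVar ''out'') ;;
     NAssign ''middle'' (NPlus (NVar ''out'') (NVar ''width'')) ;;
     When (NLess (NVar ''N'') (NVar ''middle'')) (NAssign ''middle'' (NVar ''N'')) ;;
     NAssign ''right'' (NVar ''middle'') ;;
     NAssign ''end'' (NPlus (NVar ''middle'') (NVar ''width'')) ;;
     When (NLess (NVar ''N'') (NVar ''end'')) (NAssign ''end'' (NVar ''N''))"

definition merge_least_com :: com where
  "merge_least_com =
     Cond (BAnd (NLess (NVar ''left'') (NVar ''middle''))
         (BNot (BAnd (NLess (NVar ''right'') (NVar ''end''))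
           (RLess (RArr ''values'' (NVar ''right'')) (RArr ''values'' (NVar ''left''))))))
       (RStore ''buffer'' (NVar ''out'') (RArr ''values'' (NVar ''left'')) ;; Incr ''left'')
       (RStore ''buffer'' (NVar ''out'') (RArr ''values'' (NVar ''right'')) ;; Incr ''right'')"

definition merge_step_com :: com where
  "merge_step_com = When (NLe (NVar ''end'') (NVar ''out'')) next_runs_com ;; merge_least_com"

definition copy_array_com :: "vname \<Rightarrow> vname \<Rightarrow> com" where
  "copy_array_com a a' = For ''out'' ''N'' (RStore a' (NVar ''out'') (RArr a (NVar ''out'')))"

definition merge_pass_com :: com where
  "merge_pass_com = NAssign ''end'' (NConst 0) ;; For ''out'' ''N'' merge_step_com ;;
    copy_array_com ''buffer'' ''values''"

definition sort_com :: com where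
  "sort_com = NAssign ''width'' (NConst 1) ;;
     Loop (NLess (NVar ''width'') (NVar ''N''))
       (merge_pass_com ;; NAssign ''width'' (NPlus (NVar ''width'') (NVar ''width'')))"

lemma written_merge_step [simp]:
  "written merge_step_com = {NatVar ''left'', NatVar ''middle'', NatVar ''right'', NatVar ''end'',
    RealArr ''buffer''}"
  by (auto simp: merge_step_com_def next_runs_com_def merge_least_com_def)

lemma written_copy_array [simp]: "written (copy_array_com a a') = {NatVar ''out'', RealArr a'}"
  by (simp add: copy_array_com_def)

lemma written_merge_pass [simp]:
  "written merge_pass_com =
     {NatVar ''left'', NatVar ''middle'', NatVar ''right'', NatVar ''end'', NatVar ''out'',
       RealArr ''values'', RealArr ''buffer''}"
  by (auto simp: merge_pass_com_def)

lemma written_sort [simp]: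
  "written sort_com =
     {NatVar ''width'', NatVar ''left'', NatVar ''middle'', NatVar ''right'', NatVar ''end'',
       NatVar ''out'', RealArr ''values'', RealArr ''buffer''}"
  by (auto simp: sort_com_def)

lemma copy_array_correct:
  assumes "nvar s ''N'' = N" "N \<le> rounds (NLess (NVar ''out'') (NVar ''N''))" "a \<noteq> a'"
  shows "halts rounds (copy_array_com a a') s (\<lambda>s'. \<forall>i<N. rarr s' a' i = rarr s a i)"
  unfolding copy_array_com_def
proof (rule halts_For[where N = N and I = "\<lambda>j s'. \<forall>i<j. rarr s' a' i = rarr s a i"])
  let ?c = "RStore a' (NVar ''out'') (RArr a (NVar ''out''))"
  fix j s' assume "nvar s' ''out'' = j" "\<forall>i<j. rarr s' a' i = rarr s a i"
    and frame: "eq_except (written (For ''out'' ''N'' ?c)) s s'"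
  moreover have "rarr s' a = rarr s a" using assms(3) by (simp add: eq_exceptD[OF frame])
  ultimately show "halts rounds ?c s' (\<lambda>s'. \<forall>i<Suc j. rarr s' a' i = rarr s a i)"
    by (intro halts_intros) (auto simp: less_Suc_eq)
qed (use assms in simp_all)

definition merge_invariant :: "nat \<Rightarrow> nat \<Rightarrow> (nat \<Rightarrow> real) \<Rightarrow> nat \<Rightarrow> store \<Rightarrow> bool" where
  "merge_invariant N w A p s \<longleftrightarrow>
     (if p < nvar s ''end''
      then \<exists>a. merging N w A (rarr s ''buffer'') a (nvar s ''left'') (nvar s ''middle'')
        (nvar s ''right'') (nvar s ''end'') p
      else merged w A (rarr s ''buffer'') p \<and> (p < N \<longrightarrow> 2 * w dvd p))"

lemma next_runs_correct:
  assumes "merged w A (rarr s ''buffer'') p" "2 * w dvd p" "p < N" "0 < w"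
    and "nvar s ''out'' = p" "nvar s ''N'' = N" "nvar s ''width'' = w"
  shows "halts rounds next_runs_com s (\<lambda>s'. p < nvar s' ''end'' \<and> merge_invariant N w A p s')"
proof -
  let ?u = "min N (p + w)"
  let ?e = "min N (?u + w)"
  have "halts rounds next_runs_com s (\<lambda>s'.
      nvar s' ''left'' = p \<and> nvar s' ''middle'' = ?u \<and> nvar s' ''right'' = ?u \<and>
      nvar s' ''end'' = ?e \<and> rarr s' ''buffer'' = rarr s ''buffer'')"
    unfolding next_runs_com_def using assms(5-7) by (intro halts_intros) (simp_all add: min_def)
  then show ?thesis
  proof (rule halts_conseq)
    fix s' :: store assume "nvar s' ''left'' = p \<and> nvar s' ''middle'' = ?u \<and> nvar s' ''right'' = ?u \<and>
      nvar s' ''end'' = ?e \<and> rarr s' ''buffer'' = rarr s ''buffer''"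
    then show "p < nvar s' ''end'' \<and> merge_invariant N w A p s'"
      using merging_start[OF assms(1-3)] assms(3,4) by (auto simp: merge_invariant_def)
  qed
qed

lemma merge_least_correct:
  assumes inv: "merge_invariant N w A p s" "p < nvar s ''end''" and blocks: "block_sorted w A N"
    and pre: "nvar s ''out'' = p" "rarr s ''values'' = A"
  shows "halts rounds merge_least_com s (merge_invariant N w A (Suc p))"
proof -
  let ?B = "rarr s ''buffer''" and ?i = "nvar s ''left''" and ?u = "nvar s ''middle''"
    and ?j = "nvar s ''right''" and ?e = "nvar s ''end''"
  obtain a where merging: "merging N w A ?B a ?i ?u ?j ?e p"
    using inv by (auto simp: merge_invariant_def)
  have invI: "merge_invariant N w A (Suc p) s'"
    if "merging N w A (rarr s' ''buffer'') a (nvar s' ''left'') (nvar s' ''middle'')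
        (nvar s' ''right'') (nvar s' ''end'') (Suc p)"
      "nvar s' ''end'' = ?e" for s' :: store
  proof (cases "Suc p < ?e")
    case True
    then show ?thesis using that by (auto simp: merge_invariant_def)
  next
    case False
    then have "nvar s' ''end'' = Suc p" using inv(2) that(2) by simp
    then show ?thesis using merging_finish[of N w A _ a] that(1) by (auto simp: merge_invariant_def)
  qed
  show ?thesis unfolding merge_least_com_def
  proof (intro halts_Cond)
    assume "bval (BAnd (NLess (NVar ''left'') (NVar ''middle''))
      (BNot (BAnd (NLess (NVar ''right'') (NVar ''end''))
      (RLess (RArr ''values'' (NVar ''right'')) (RArr ''values'' (NVar ''left'')))))) s"
    then have "merging N w A (?B(p := A ?i)) a (Suc ?i) ?u ?j ?e (Suc p)"
      using pre by (intro merging_left[OF merging blocks]) auto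
    then show "halts rounds
        (RStore ''buffer'' (NVar ''out'') (RArr ''values'' (NVar ''left'')) ;; Incr ''left'')
        s (merge_invariant N w A (Suc p))"
      using pre by (intro halts_intros invI) simp_all
  next
    assume "\<not> bval (BAnd (NLess (NVar ''left'') (NVar ''middle''))
      (BNot (BAnd (NLess (NVar ''right'') (NVar ''end''))
      (RLess (RArr ''values'' (NVar ''right'')) (RArr ''values'' (NVar ''left'')))))) s"
    moreover have "?i < ?u \<or> ?j < ?e" using merging inv(2) by (auto simp: merging_def)
    ultimately have "merging N w A (?B(p := A ?j)) a ?i ?u (Suc ?j) ?e (Suc p)"
      using pre by (intro merging_right[OF merging blocks]) auto
    then show "halts rounds
        (RStore ''buffer'' (NVar ''out'') (RArr ''values'' (NVar ''right'')) ;; Incr ''right'')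
        s (merge_invariant N w A (Suc p))"
      using pre by (intro halts_intros invI) simp_all
  qed
qed

lemma merge_step_correct:
  assumes inv: "merge_invariant N w A p s" and blocks: "block_sorted w A N" and w_pos: "0 < w"
    and p_less: "p < N"
    and pre: "nvar s ''out'' = p" "nvar s ''N'' = N" "nvar s ''width'' = w" "rarr s ''values'' = A"
  shows "halts rounds merge_step_com s (merge_invariant N w A (Suc p))"
proof -
  let ?c = "When (NLe (NVar ''end'') (NVar ''out'')) next_runs_com"
  have "halts rounds ?c s
      (\<lambda>s'. p < nvar s' ''end'' \<and> merge_invariant N w A p s')"
  proof (intro halts_Cond halts_Skip next_runs_correct)
  qed (use assms in \<open>auto simp: merge_invariant_def\<close>)
  then show ?thesis unfolding merge_step_com_def
  proof (rule halts_Seq_conseq)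
    fix s' assume frame: "eq_except (written ?c) s s'"
      and "p < nvar s' ''end'' \<and> merge_invariant N w A p s'"
    then show "halts rounds merge_least_com s' (merge_invariant N w A (Suc p))"
      using blocks w_pos pre
      by (intro merge_least_correct) (auto simp: eq_exceptD[OF frame] next_runs_com_def)
  qed
qed

lemma merge_pass_correct:
  assumes pre: "nvar s ''N'' = N" "N \<le> rounds (NLess (NVar ''out'') (NVar ''N''))"
    and width: "nvar s ''width'' = w" "0 < w" and blocks: "block_sorted w (rarr s ''values'') N"
  shows "halts rounds merge_pass_com s (\<lambda>s'. merged w (rarr s ''values'') (rarr s' ''values'') N)"
  unfolding merge_pass_com_def
proof (rule halts_Seq, rule halts_NAssign)
  let ?A = "rarr s ''values''" and ?s = "set_nvar ''end'' 0 s"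
  have "halts rounds (For ''out'' ''N'' merge_step_com) ?s (\<lambda>s'. merged w ?A (rarr s' ''buffer'') N)"
  proof (rule halts_For[where N = N and I = "merge_invariant N w ?A"])
    show "merge_invariant N w ?A 0 ?s"
      by (simp add: merge_invariant_def merged_def block_sorted_def)
  next
    fix p s' assume "p < N" "nvar s' ''out'' = p" "merge_invariant N w ?A p s'"
      and frame: "eq_except (written (For ''out'' ''N'' merge_step_com)) ?s s'"
    then show "halts rounds merge_step_com s' (merge_invariant N w ?A (Suc p))"
      using pre width blocks by (intro merge_step_correct) (simp_all add: eq_exceptD[OF frame])
  next
    fix s' assume "merge_invariant N w ?A N s'"
    then show "merged w ?A (rarr s' ''buffer'') N"
      by (auto simp: merge_invariant_def dest: mergingD(5) split: if_splits)
  qed (use pre in \<open>auto simp: merge_invariant_def\<close>)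
  then have "halts rounds (For ''out'' ''N'' merge_step_com ;; copy_array_com ''buffer'' ''values'') ?s
      (\<lambda>s'. merged w ?A (rarr s' ''values'') N)"
  proof (rule halts_Seq_conseq)
    fix s' assume frame: "eq_except (written (For ''out'' ''N'' merge_step_com)) ?s s'"
      and merged: "merged w ?A (rarr s' ''buffer'') N"
    have "nvar s' ''N'' = N" using pre by (simp add: eq_exceptD[OF frame])
    then have "halts rounds (copy_array_com ''buffer'' ''values'') s'
      (\<lambda>s''. \<forall>i<N. rarr s'' ''values'' i = rarr s' ''buffer'' i)"
      using pre(2) by (rule copy_array_correct) simp
    then show "halts rounds (copy_array_com ''buffer'' ''values'') s'
      (\<lambda>s'. merged w ?A (rarr s' ''values'') N)"
    proof (rule halts_conseq)
      fix s'' assume "\<forall>i<N. rarr s'' ''values'' i = rarr s' ''buffer'' i"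
      then show "merged w ?A (rarr s'' ''values'') N"
        using merged merged_cong[of N "rarr s'' ''values''" "rarr s' ''buffer''"] by simp
    qed
  qed
  then show "halts rounds (For ''out'' ''N'' merge_step_com ;; copy_array_com ''buffer'' ''values'')
      (s\<lparr>nvar := (nvar s)(''end'' := nval (NConst 0) s)\<rparr>) (\<lambda>s'. merged w ?A (rarr s' ''values'') N)"
        by simp
qed

lemma sort_correct:
  assumes pre: "nvar s ''N'' = N" "N \<le> rounds (NLess (NVar ''out'') (NVar ''N''))"
      "N \<le> 2 ^ rounds (NLess (NVar ''width'') (NVar ''N''))"
  shows "halts rounds sort_com s
    (\<lambda>s'. mono_on {..<N} (rarr s' ''values'') \<and>
      rarr s' ''values'' ` {..<N} = rarr s ''values'' ` {..<N})"
proof -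
  let ?A = "rarr s ''values''" and ?s = "set_nvar ''width'' 1 s"
  let ?double = "NAssign ''width'' (NPlus (NVar ''width'') (NVar ''width''))"
  define I where "I q s' \<longleftrightarrow> nvar s' ''N'' = N \<and> 0 < nvar s' ''width'' \<and> N \<le> nvar s' ''width'' * 2 ^ q \<and>
    block_sorted (nvar s' ''width'') (rarr s' ''values'') N \<and> rarr s' ''values'' ` {..<N} = ?A ` {..<N}"
    for q and s' :: store
  have "halts rounds (Loop (NLess (NVar ''width'') (NVar ''N'')) (merge_pass_com ;; ?double)) ?s
    (\<lambda>s'. mono_on {..<N} (rarr s' ''values'') \<and> rarr s' ''values'' ` {..<N} = ?A ` {..<N})"
  proof (rule halts_Loop[where I = I, OF _ order_refl])
    fix q s' assume inv: "I (Suc q) s'"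
    then have "halts rounds merge_pass_com s'
      (\<lambda>s''. merged (nvar s' ''width'') (rarr s' ''values'') (rarr s'' ''values'') N)"
      using pre(2) by (intro merge_pass_correct) (auto simp: I_def)
    then show "halts rounds (merge_pass_com ;; ?double) s' (I q)"
    proof (rule halts_Seq_conseq)
      fix s'' assume frame: "eq_except (written merge_pass_com) s' s''"
        and "merged (nvar s' ''width'') (rarr s' ''values'') (rarr s'' ''values'') N"
      then show "halts rounds ?double s'' (I q)"
        using inv
        by (intro halts_intros) (simp add: I_def merged_def eq_exceptD[OF frame] mult_2 algebra_simps)
    qed
  qed (use pre in \<open>auto simp: I_def block_sorted_Suc_0 mono_on_if_block_sorted\<close>)
  then show ?thesis unfolding sort_com_def by (intro halts_Seq halts_NAssign) simp
qed

section \<open>Testing a radius\<close>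

abbreviation Marked :: "vname \<Rightarrow> nexp \<Rightarrow> bexp" where
  "Marked a e \<equiv> NLess (NConst 0) (NArr a e)"

abbreviation Dist :: "vname \<Rightarrow> nexp \<Rightarrow> rexp" where
  "Dist i e \<equiv> RArr ''d'' (NPlus (NArr ''row'' (NVar i)) e)"

definition reset_com :: com where
  "reset_com = For ''i'' ''n''
     (NStore ''net'' (NVar ''i'') (NConst 0) ;; NStore ''covered'' (NVar ''i'') (NConst 0) ;;
      NStore ''centers'' (NVar ''i'') (NConst 0) ;; NStore ''weight'' (NVar ''i'') (NConst 0))"

definition cover_com :: com where
  "cover_com = For ''j'' ''n''
     (When (BAnd (BNot (Marked ''covered'' (NVar ''j'')))
         (RLe (Dist ''i'' (NVar ''j'')) (RPlus (RVar ''radius'') (RVar ''radius''))))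
       (NStore ''covered'' (NVar ''j'') (NConst 1) ;; NStore ''rep'' (NVar ''j'') (NVar ''i'')))"

definition extend_net_com :: com where
  "extend_net_com = NStore ''net'' (NVar ''i'') (NConst 1) ;; Incr ''size'' ;; cover_com"

definition net_com :: com where
  "net_com = NAssign ''size'' (NConst 0) ;;
     For ''i'' ''n'' (When (BNot (Marked ''covered'' (NVar ''i''))) extend_net_com)"

definition weights_com :: com where
  "weights_com = For ''i'' ''n''
     (When (RLe (Dist ''i'' (NArr ''lH'' (NVar ''i''))) (RVar ''radius''))
       (NStore ''weight'' (NArr ''lH'' (NVar ''i''))
         (NPlus (NArr ''weight'' (NArr ''lH'' (NVar ''i''))) (NConst 1))))"

definition heaviest_com :: "bexp \<Rightarrow> com" where
  "heaviest_com p = NAssign ''top'' (NConst 0) ;; For ''j'' ''n''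
     (When (BAnd p (NLe (NVar ''top'') (NArr ''weight'' (NVar ''j''))))
       (NAssign ''top'' (NArr ''weight'' (NVar ''j'')) ;; NAssign ''best'' (NVar ''j'')))"

definition best_center_com :: com where
  "best_center_com = NAssign ''best'' (NVar ''i'') ;;
     heaviest_com (BAnd (Marked ''H'' (NVar ''j'')) (RLe (Dist ''i'' (NVar ''j'')) (RVar ''radius'')))"

definition assign_center_com :: com where
  "assign_center_com = best_center_com ;;
     NStore ''center'' (NVar ''i'') (NVar ''best'') ;; NStore ''centers'' (NVar ''best'') (NConst 1)"

definition centers_com :: com where
  "centers_com = For ''i'' ''n'' (When (Marked ''net'' (NVar ''i'')) assign_center_com)"

definition add_center_com :: com where
  "add_center_com =
     heaviest_com (BAnd (Marked ''H'' (NVar ''j'')) (BNot (Marked ''centers'' (NVar ''j'')))) ;;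
     NStore ''centers'' (NVar ''best'') (NConst 1)"

definition fill_com :: com where
  "fill_com = NAssign ''missing'' (NMinus (NVar ''k'') (NVar ''size'')) ;;
    For ''q'' ''missing'' add_center_com"

definition label_com :: com where
  "label_com = NAssign ''changed'' (NConst 0) ;; For ''i'' ''n''
     (Cond (BAnd (Marked ''centers'' (NArr ''lH'' (NVar ''i'')))
         (RLe (Dist ''i'' (NArr ''lH'' (NVar ''i''))) (RVar ''radius'')))
       (NStore ''label'' (NVar ''i'') (NArr ''lH'' (NVar ''i'')))
       (NStore ''label'' (NVar ''i'') (NArr ''center'' (NArr ''rep'' (NVar ''i''))) ;;
         Incr ''changed''))"

definition prepare_com :: com where
  "prepare_com = reset_com ;; net_com ;; weights_com"

definition select_com :: com where
  "select_com = prepare_com ;; centers_com ;; fill_com"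

definition check_com :: com where
  "check_com = select_com ;; label_com"

lemma written_cover [simp]: "written cover_com = {NatVar ''j'', NatArr ''covered'', NatArr ''rep''}"
  by (auto simp: cover_com_def)

lemma written_heaviest [simp]:
  "written (heaviest_com p) = {NatVar ''top'', NatVar ''j'', NatVar ''best''}"
  by (auto simp: heaviest_com_def)

lemma written_extend_net [simp]:
  "written extend_net_com = {NatVar ''j'', NatVar ''size'', NatArr ''net'', NatArr ''covered'',
    NatArr ''rep''}"
  by (auto simp: extend_net_com_def)

lemma written_best_center [simp]:
  "written best_center_com = {NatVar ''top'', NatVar ''j'', NatVar ''best''}"
  by (auto simp: best_center_com_def)

lemma written_assign_center [simp]:
  "written assign_center_com = {NatVar ''top'', NatVar ''j'', NatVar ''best'', NatArr ''center'',
    NatArr ''centers''}"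
  by (auto simp: assign_center_com_def)

lemma written_add_center [simp]:
  "written add_center_com = {NatVar ''top'', NatVar ''j'', NatVar ''best'', NatArr ''centers''}"
  by (auto simp: add_center_com_def)

lemma written_stages [simp]:
  "written reset_com = {NatVar ''i'', NatArr ''net'', NatArr ''covered'', NatArr ''centers'',
    NatArr ''weight''}"
  "written net_com = {NatVar ''i'', NatVar ''j'', NatVar ''size'', NatArr ''net'',
    NatArr ''covered'', NatArr ''rep''}"
  "written weights_com = {NatVar ''i'', NatArr ''weight''}"
  "written centers_com =
     {NatVar ''i'', NatVar ''top'', NatVar ''j'', NatVar ''best'', NatArr ''center'',
       NatArr ''centers''}"
  "written fill_com = {NatVar ''missing'', NatVar ''q'', NatVar ''top'', NatVar ''j'',
    NatVar ''best'', NatArr ''centers''}"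
  "written label_com = {NatVar ''i'', NatVar ''changed'', NatArr ''label''}"
  by (auto simp: reset_com_def net_com_def weights_com_def centers_com_def fill_com_def label_com_def)

lemma written_check [simp]:
  "written prepare_com =
     {NatVar ''i'', NatVar ''j'', NatVar ''size'', NatArr ''net'', NatArr ''covered'',
       NatArr ''rep'', NatArr ''centers'', NatArr ''weight''}"
  "written select_com =
     written prepare_com \<union> {NatVar ''top'', NatVar ''best'', NatVar ''missing'', NatVar ''q'',
       NatArr ''center''}"
  "written check_com = written select_com \<union> {NatVar ''changed'', NatArr ''label''}"
  by (auto simp: prepare_com_def select_com_def check_com_def)

definition support :: "nat \<Rightarrow> (nat \<Rightarrow> nat) \<Rightarrow> nat set" where
  "support n f = {i. i < n \<and> f i \<noteq> 0}"

lemma in_support: "i < n \<Longrightarrow> i \<in> support n f \<longleftrightarrow> 0 < f i"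
  by (simp add: support_def)

lemma support_subset: "support n f \<subseteq> {..<n}"
  by (auto simp: support_def)

lemma finite_support [simp]: "finite (support n f)"
  using support_subset finite_lessThan by (rule finite_subset)

lemma support_mark [simp]: "i < n \<Longrightarrow> support n (f(i := Suc v)) = insert i (support n f)"
  by (auto simp: support_def)

lemma heaviest_correct:
  assumes pre: "nvar s ''n'' = n" "n \<le> rounds (NLess (NVar ''j'') (NVar ''n''))"
    and A_subset: "A \<subseteq> {..<n}"
    and test: "\<And>s'. eq_except (written (heaviest_com p)) s s' \<Longrightarrow> nvar s' ''j'' < n \<Longrightarrow>
      bval p s' \<longleftrightarrow> nvar s' ''j'' \<in> A"
  shows "halts rounds (heaviest_com p) s
    (\<lambda>s'. heaviest_or_default (narr s ''weight'') A (nvar s ''best'') (nvar s' ''best''))"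
proof -
  let ?w = "narr s ''weight''" and ?s = "set_nvar ''top'' 0 s"
  let ?c = "When (BAnd p (NLe (NVar ''top'') (NArr ''weight'' (NVar ''j''))))
       (NAssign ''top'' (NArr ''weight'' (NVar ''j'')) ;; NAssign ''best'' (NVar ''j''))"
  define I where "I j s' \<longleftrightarrow>
      heaviest_or_default ?w (A \<inter> {..<j}) (nvar s ''best'') (nvar s' ''best'') \<and>
      nvar s' ''top'' = (if A \<inter> {..<j} = {} then 0 else ?w (nvar s' ''best''))" for j and s' :: store
  have "halts rounds (For ''j'' ''n'' ?c) ?s
    (\<lambda>s'. heaviest_or_default ?w A (nvar s ''best'') (nvar s' ''best''))"
  proof (rule halts_For[where N = n and I = I])
    fix j s' assume loop: "j < n" "nvar s' ''j'' = j" and inv: "I j s'"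
      and frame: "eq_except (written (For ''j'' ''n'' ?c)) ?s s'"
    have "eq_except (written (heaviest_com p)) s s'" using frame by (auto simp: eq_except_def)
    then have test_j: "bval p s' \<longleftrightarrow> j \<in> A" using test loop by auto
    have weights: "narr s' ''weight'' = ?w" by (simp add: eq_exceptD[OF frame])
    have upto: "A \<inter> {..<Suc j} = (if j \<in> A then insert j (A \<inter> {..<j}) else A \<inter> {..<j})"
      by (auto simp: less_Suc_eq)
    have "heaviest_or_default ?w (A \<inter> {..<Suc j}) (nvar s ''best'')
        (if j \<in> A \<and> nvar s' ''top'' \<le> ?w j then j else nvar s' ''best'')"
      using inv heaviest_or_default_insert[of ?w "A \<inter> {..<j}" "nvar s ''best''" "nvar s' ''best''" j]
      by (auto simp: I_def upto split: if_splits)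
    then show "halts rounds ?c s' (I (Suc j))"
      using inv test_j weights loop by (intro halts_intros) (auto simp: I_def upto split: if_splits)
  next
    fix s' assume "I n s'"
    then show "heaviest_or_default ?w A (nvar s ''best'') (nvar s' ''best'')"
      using A_subset by (simp add: I_def Int_absorb2)
  qed (use pre in \<open>auto simp: I_def heaviest_or_default_def\<close>)
  then show ?thesis unfolding heaviest_com_def by (intro halts_Seq halts_NAssign) simp
qed

locale indexed_instance = label_consistent "{..<n :: nat}" D k b \<H> for n D k b \<H> +
  fixes rounds :: "bexp \<Rightarrow> nat"
  assumes rounds_n: "n \<le> rounds (NLess (NVar i) (NVar ''n''))"
    and rounds_missing: "n \<le> rounds (NLess (NVar ''q'') (NVar ''missing''))"
begin

definition inputs :: "store \<Rightarrow> bool" where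
  "inputs s \<longleftrightarrow> nvar s ''n'' = n \<and> nvar s ''k'' = k \<and> nvar s ''b'' = b \<and>
     support n (narr s ''H'') = fst \<H> \<and> (\<forall>i<n. narr s ''lH'' i = snd \<H> i) \<and>
     (\<forall>i<n. \<forall>j<n. rarr s ''d'' (narr s ''row'' i + j) = D i j)"

abbreviation input_locations :: "location set" where
  "input_locations \<equiv>
     {NatVar ''n'', NatVar ''k'', NatVar ''b'', NatArr ''H'', NatArr ''lH'', NatArr ''row'',
       RealArr ''d''}"

lemma inputs_frame:
  assumes "inputs s" "eq_except W s s'" "input_locations \<inter> W = {}"
  shows "inputs s'"
  using assms(1,3) by (simp add: inputs_def eq_exceptD[OF assms(2)])

definition net_stored :: "real \<Rightarrow> store \<Rightarrow> bool" where
  "net_stored r s \<longleftrightarrow> net r (support n (narr s ''net'')) (narr s ''rep'') \<and>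
     nvar s ''size'' = card (support n (narr s ''net''))"

definition weights_stored :: "real \<Rightarrow> store \<Rightarrow> bool" where
  "weights_stored r s \<longleftrightarrow> (\<forall>h<n. narr s ''weight'' h = weight r h)"

lemma reset_correct:
  assumes "inputs s"
  shows "halts rounds reset_com s (\<lambda>s'.
    support n (narr s' ''net'') = {} \<and> support n (narr s' ''covered'') = {} \<and>
    support n (narr s' ''centers'') = {} \<and> support n (narr s' ''weight'') = {})"
  unfolding reset_com_def
proof (rule halts_For[where N = n and
  I = "\<lambda>j s'. \<forall>a\<in>{''net'', ''covered'', ''centers'', ''weight''}. \<forall>i<j. narr s' a i = 0"])
  fix j and s' :: store assume "nvar s' ''i'' = j"
    "\<forall>a\<in>{''net'', ''covered'', ''centers'', ''weight''}. \<forall>i<j. narr s' a i = 0"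
  then show "halts rounds
      (NStore ''net'' (NVar ''i'') (NConst 0) ;; NStore ''covered'' (NVar ''i'') (NConst 0) ;;
       NStore ''centers'' (NVar ''i'') (NConst 0) ;; NStore ''weight'' (NVar ''i'') (NConst 0)) s'
      (\<lambda>s'. \<forall>a\<in>{''net'', ''covered'', ''centers'', ''weight''}. \<forall>i<Suc j. narr s' a i = 0)"
    by (intro halts_intros) (simp add: less_Suc_eq)
qed (use assms rounds_n in \<open>auto simp: inputs_def support_def\<close>)

definition covered_from :: "real \<Rightarrow> nat \<Rightarrow> nat set \<Rightarrow> store \<Rightarrow> store \<Rightarrow> bool" where
  "covered_from r i Y s s' \<longleftrightarrow>
     support n (narr s' ''covered'') = support n (narr s ''covered'') \<union> {y \<in> Y. D i y \<le> 2 * r} \<and>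
     (\<forall>y\<in>support n (narr s ''covered''). narr s' ''rep'' y = narr s ''rep'' y) \<and>
     (\<forall>y\<in>Y - support n (narr s ''covered''). D i y \<le> 2 * r \<longrightarrow> narr s' ''rep'' y = i)"

lemma cover_correct:
  assumes pre: "inputs s" "rvar s ''radius'' = r" "nvar s ''i'' = i" "i < n"
  shows "halts rounds cover_com s (covered_from r i {..<n} s)"
  unfolding cover_com_def
proof (rule halts_For[where N = n and I = "\<lambda>j. covered_from r i {..<j} s"])
  let ?c = "When (BAnd (BNot (Marked ''covered'' (NVar ''j'')))
         (RLe (Dist ''i'' (NVar ''j'')) (RPlus (RVar ''radius'') (RVar ''radius''))))
       (NStore ''covered'' (NVar ''j'') (NConst 1) ;; NStore ''rep'' (NVar ''j'') (NVar ''i''))"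
  fix j s' assume loop: "j < n" "nvar s' ''j'' = j" and covered: "covered_from r i {..<j} s s'"
    and frame: "eq_except (written (For ''j'' ''n'' ?c)) s s'"
  have "inputs s'" by (rule inputs_frame[OF pre(1) frame]) simp
  then have dist: "rarr s' ''d'' (narr s' ''row'' i + j) = D i j"
    using pre(4) loop(1) by (simp add: inputs_def)
  have same: "rvar s' ''radius'' = r" "nvar s' ''i'' = i"
    using pre by (simp_all add: eq_exceptD[OF frame])
  have "narr s' ''covered'' j \<noteq> 0 \<longleftrightarrow> j \<in> support n (narr s ''covered'')"
    using covered in_support[OF loop(1), of "narr s' ''covered''"] by (auto simp: covered_from_def)
  then show "halts rounds ?c s' (covered_from r i {..<Suc j} s)"
    using covered loop dist same by (intro halts_intros) (auto simp: covered_from_def less_Suc_eq)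
qed (use pre rounds_n in \<open>simp_all add: covered_from_def inputs_def\<close>)

definition net_invariant :: "real \<Rightarrow> nat \<Rightarrow> store \<Rightarrow> bool" where
  "net_invariant r i s \<longleftrightarrow>
     partial_net r (support n (narr s ''net'')) (support n (narr s ''covered'')) (narr s ''rep'') \<and>
     {..<i} \<subseteq> support n (narr s ''covered'') \<and> nvar s ''size'' = card (support n (narr s ''net''))"

lemma extend_net_correct:
  assumes pre: "inputs s" "rvar s ''radius'' = r" "0 \<le> r" "nvar s ''i'' = i" "i < n"
    and inv: "net_invariant r i s" and uncovered: "i \<notin> support n (narr s ''covered'')"
  shows "halts rounds extend_net_com s (net_invariant r (Suc i))"
proof -
  let ?S = "support n (narr s ''net'')" and ?cov = "support n (narr s ''covered'')"
  let ?s = "s\<lparr>narr := (narr s)(''net'' := (narr s ''net'')(i := 1)),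
    nvar := (nvar s)(''size'' := nvar s ''size'' + 1)\<rparr>"
  have "inputs ?s" using pre(1) by (simp add: inputs_def)
  then have "halts rounds cover_com ?s (net_invariant r (Suc i))"
  proof (rule halts_conseq[OF cover_correct[where i = i and r = r]])
    fix s' assume frame: "eq_except (written cover_com) ?s s'"
      and covered: "covered_from r i {..<n} ?s s'"
    have "i \<notin> ?S" using inv uncovered by (auto simp: net_invariant_def partial_net_def)
    then have "support n (narr s' ''net'') = insert i ?S" "nvar s' ''size'' = card (insert i ?S)"
      using inv pre(5) by (simp_all add: eq_exceptD[OF frame] net_invariant_def)
    moreover have "partial_net r (insert i ?S) (?cov \<union> {y \<in> {..<n}. D i y \<le> 2 * r}) (narr s' ''rep'')"
      using inv uncovered covered pre(3,5)
      by (intro partial_net_insert) (auto simp: net_invariant_def covered_from_def)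
    moreover have "i \<in> {y \<in> {..<n}. D i y \<le> 2 * r}" using pre(3,5) by simp
    ultimately show "net_invariant r (Suc i) s'"
      using inv covered by (auto simp: net_invariant_def covered_from_def less_Suc_eq)
  qed (use pre in simp_all)
  then show ?thesis unfolding extend_net_com_def
    using pre(4) by (intro halts_Seq halts_NStore halts_NAssign) simp
qed

lemma net_correct:
  assumes pre: "inputs s" "rvar s ''radius'' = r" "0 \<le> r"
    and empty: "support n (narr s ''net'') = {}" "support n (narr s ''covered'') = {}"
  shows "halts rounds net_com s (net_stored r)"
proof -
  let ?c = "When (BNot (Marked ''covered'' (NVar ''i''))) extend_net_com"
    and ?s = "set_nvar ''size'' 0 s"
  have "halts rounds (For ''i'' ''n'' ?c) ?s (net_stored r)"
  proof (rule halts_For[where N = n and I = "net_invariant r"])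
    fix i s' assume loop: "i < n" "nvar s' ''i'' = i" and inv: "net_invariant r i s'"
      and frame: "eq_except (written (For ''i'' ''n'' ?c)) ?s s'"
    have "inputs s'" by (rule inputs_frame[OF pre(1) eq_except_set_nvar[OF frame]]) simp
    moreover have "rvar s' ''radius'' = r" using pre(2) by (simp add: eq_exceptD[OF frame])
    moreover have "net_invariant r (Suc i) s'" if "i \<in> support n (narr s' ''covered'')"
      using inv that by (auto simp: net_invariant_def less_Suc_eq)
    ultimately show "halts rounds ?c s' (net_invariant r (Suc i))"
      using loop inv pre(3)
      by (intro halts_Cond halts_Skip extend_net_correct) (simp_all add: in_support)
  next
    fix s' assume inv: "net_invariant r n s'"
    then have "support n (narr s' ''covered'') = {..<n}"
      using support_subset by (auto simp: net_invariant_def)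
    then show "net_stored r s'"
      using inv by (simp add: net_invariant_def net_stored_def net_if_partial_net)
  qed (use pre rounds_n empty in \<open>simp_all add: net_invariant_def inputs_def partial_net_empty\<close>)
  then show ?thesis unfolding net_com_def by (intro halts_Seq halts_NAssign) simp
qed

lemma weights_correct:
  assumes pre: "inputs s" "rvar s ''radius'' = r" "support n (narr s ''weight'') = {}"
  shows "halts rounds weights_com s (weights_stored r)"
  unfolding weights_com_def
proof (rule halts_For[where N = n and
      I = "\<lambda>i s'. \<forall>h<n. narr s' ''weight'' h = card {x. x < i \<and> snd \<H> x = h \<and> D x h \<le> r}"])
  let ?c = "When (RLe (Dist ''i'' (NArr ''lH'' (NVar ''i''))) (RVar ''radius''))
       (NStore ''weight'' (NArr ''lH'' (NVar ''i''))
         (NPlus (NArr ''weight'' (NArr ''lH'' (NVar ''i''))) (NConst 1)))"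
  let ?count = "\<lambda>i h. {x. x < i \<and> snd \<H> x = h \<and> D x h \<le> r}"
  fix i s' assume loop: "i < n" "nvar s' ''i'' = i"
    and inv: "\<forall>h<n. narr s' ''weight'' h = card (?count i h)"
    and frame: "eq_except (written (For ''i'' ''n'' ?c)) s s'"
  have inputs: "inputs s'" by (rule inputs_frame[OF pre(1) frame]) simp
  have radius: "rvar s' ''radius'' = r" using pre by (simp add: eq_exceptD[OF frame])
  have label: "narr s' ''lH'' i = snd \<H> i" "snd \<H> i < n"
    and dist: "rarr s' ''d'' (narr s' ''row'' i + snd \<H> i) = D i (snd \<H> i)"
    using inputs loop label_in_X[of i] by (auto simp: inputs_def)
  have "?count (Suc i) h = (if snd \<H> i = h \<and> D i h \<le> r then insert i (?count i h) else ?count i h)"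
    for h
    by (auto simp: less_Suc_eq)
  then have "card (?count (Suc i) h) =
      card (?count i h) + (if snd \<H> i = h \<and> D i (snd \<H> i) \<le> r then 1 else 0)" for h
    by auto
  then show "halts rounds ?c s' (\<lambda>s'. \<forall>h<n. narr s' ''weight'' h = card (?count (Suc i) h))"
    using inv label dist loop radius by (intro halts_intros) auto
qed (use pre rounds_n in \<open>auto simp: inputs_def weights_stored_def weight_def support_def\<close>)

lemma heaviest_or_default_weights_stored:
  assumes "weights_stored r s" "A \<subseteq> {..<n}"
  shows "heaviest_or_default (narr s ''weight'') A z c \<longleftrightarrow> heaviest_or_default (weight r) A z c"
  using assms by (intro heaviest_or_default_cong) (auto simp: weights_stored_def)

lemma best_center_correct:
  assumes pre: "inputs s" "rvar s ''radius'' = r" "weights_stored r s" "nvar s ''i'' = i" "i < n"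
  shows "halts rounds best_center_com s (\<lambda>s'. best_center r i (nvar s' ''best''))"
proof -
  let ?p = "BAnd (Marked ''H'' (NVar ''j'')) (RLe (Dist ''i'' (NVar ''j'')) (RVar ''radius''))"
  let ?s = "set_nvar ''best'' i s" and ?A = "{h \<in> fst \<H>. D i h \<le> r}"
  have A_subset: "?A \<subseteq> {..<n}" using \<H>_subset by blast
  have "halts rounds (heaviest_com ?p) ?s (\<lambda>s'. best_center r i (nvar s' ''best''))"
  proof (rule halts_conseq[OF heaviest_correct[where A = ?A]])
    fix s' assume frame: "eq_except (written (heaviest_com ?p)) ?s s'"
      and j_less: "nvar s' ''j'' < n"
    have "inputs s'" by (rule inputs_frame[OF pre(1) eq_except_set_nvar[OF frame]]) simp
    then show "bval ?p s' \<longleftrightarrow> nvar s' ''j'' \<in> ?A"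
      using pre j_less by (auto simp: inputs_def eq_exceptD[OF frame] simp flip: in_support)
  next
    fix s' assume "heaviest_or_default (narr ?s ''weight'') ?A (nvar ?s ''best'') (nvar s' ''best'')"
    then show "best_center r i (nvar s' ''best'')"
      using heaviest_or_default_weights_stored[OF pre(3) A_subset] by (simp add: best_center_def)
  qed (use pre rounds_n A_subset in \<open>simp_all add: inputs_def\<close>)
  then show ?thesis unfolding best_center_com_def
    using pre(4) by (intro halts_Seq halts_NAssign) simp
qed

definition centers_stored :: "real \<Rightarrow> nat set \<Rightarrow> store \<Rightarrow> bool" where
  "centers_stored r S s \<longleftrightarrow> (\<forall>x\<in>S. best_center r x (narr s ''center'' x)) \<and>
     support n (narr s ''centers'') = narr s ''center'' ` S"

lemma assign_center_correct:
  assumes pre: "inputs s" "rvar s ''radius'' = r" "weights_stored r s" "nvar s ''i'' = i" "i < n"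
    and "0 \<le> r" "centers_stored r S s" "i \<notin> S"
  shows "halts rounds assign_center_com s (centers_stored r (insert i S))"
  unfolding assign_center_com_def
proof (rule halts_Seq_conseq[OF best_center_correct[OF pre]])
  fix s' assume frame: "eq_except (written best_center_com) s s'"
    and best: "best_center r i (nvar s' ''best'')"
  then have "nvar s' ''best'' < n" using best_center_near(1) assms(5,6) by simp
  moreover have "S \<inter> {x. x \<noteq> i} = S" using \<open>i \<notin> S\<close> by auto
  ultimately show "halts rounds (NStore ''center'' (NVar ''i'') (NVar ''best'') ;;
      NStore ''centers'' (NVar ''best'') (NConst 1)) s' (centers_stored r (insert i S))"
    using best assms(4,7)
    by (intro halts_intros) (simp add: centers_stored_def eq_exceptD[OF frame])
qed

lemma centers_correct:
  assumes pre: "inputs s" "rvar s ''radius'' = r" "weights_stored r s" "0 \<le> r"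
    "support n (narr s ''centers'') = {}"
  shows "halts rounds centers_com s (centers_stored r (support n (narr s ''net'')))"
proof -
  let ?S = "support n (narr s ''net'')"
    and ?c = "When (Marked ''net'' (NVar ''i'')) assign_center_com"
  show ?thesis unfolding centers_com_def
  proof (rule halts_For[where N = n and I = "\<lambda>i. centers_stored r (?S \<inter> {..<i})"])
    fix i s' assume loop: "i < n" "nvar s' ''i'' = i"
      and stored: "centers_stored r (?S \<inter> {..<i}) s'"
      and frame: "eq_except (written (For ''i'' ''n'' ?c)) s s'"
    have inputs: "inputs s'" by (rule inputs_frame[OF pre(1) frame]) simp
    have "rvar s' ''radius'' = r" "weights_stored r s'" "narr s' ''net'' = narr s ''net''"
      using pre by (simp_all add: weights_stored_def eq_exceptD[OF frame])
    moreover have "?S \<inter> {..<Suc i} = (if i \<in> ?S then insert i (?S \<inter> {..<i}) else ?S \<inter> {..<i})"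
      by (auto simp: less_Suc_eq)
    ultimately show "halts rounds ?c s' (centers_stored r (?S \<inter> {..<Suc i}))"
      using inputs loop pre(4) stored
      by (intro halts_Cond) (auto simp: in_support intro: halts_Skip assign_center_correct)
  next
    fix s' assume "centers_stored r (?S \<inter> {..<n}) s'"
    then show "centers_stored r ?S s'" using support_subset[of n] by (simp add: Int_absorb2)
  qed (use pre rounds_n in \<open>simp_all add: centers_stored_def inputs_def\<close>)
qed

definition filled_up :: "real \<Rightarrow> nat set \<Rightarrow> nat \<Rightarrow> store \<Rightarrow> bool" where
  "filled_up r B q s \<longleftrightarrow> (\<exists>E. heaviest_subset (weight r) (fst \<H> - B) E \<and> card E = q \<and>
     support n (narr s ''centers'') = B \<union> E)"

lemma add_center_correct:
  assumes pre: "inputs s" "weights_stored r s" and "filled_up r B q s" "finite B" "q < k - card B"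
  shows "halts rounds add_center_com s (filled_up r B (Suc q))"
proof -
  let ?p = "BAnd (Marked ''H'' (NVar ''j'')) (BNot (Marked ''centers'' (NVar ''j'')))"
  from assms(3) obtain E where heaviest: "heaviest_subset (weight r) (fst \<H> - B) E" "card E = q"
    and chosen: "support n (narr s ''centers'') = B \<union> E" by (auto simp: filled_up_def)
  let ?A = "fst \<H> - B - E"
  have A_subset: "?A \<subseteq> {..<n}" using \<H>_subset by blast
  have "finite E"
    using heaviest(1) finite_\<H> by (auto simp: heaviest_subset_def intro: finite_subset)
  then have "\<not> fst \<H> \<subseteq> B \<union> E"
    using card_mono[of "B \<union> E" "fst \<H>"] card_Un_le[of B E] assms(4,5) heaviest(2) card_\<H> by auto
  then have nonempty: "?A \<noteq> {}" by blast
  show ?thesis unfolding add_center_com_def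
  proof (rule halts_Seq_conseq[OF heaviest_correct[where A = ?A]])
    fix s' assume frame: "eq_except (written (heaviest_com ?p)) s s'"
      and j_less: "nvar s' ''j'' < n"
    have "inputs s'" by (rule inputs_frame[OF pre(1) frame]) simp
    then show "bval ?p s' \<longleftrightarrow> nvar s' ''j'' \<in> ?A"
      using chosen j_less by (auto simp: inputs_def eq_exceptD[OF frame] simp flip: in_support)
  next
    fix s' assume frame: "eq_except (written (heaviest_com ?p)) s s'"
      and "heaviest_or_default (narr s ''weight'') ?A (nvar s ''best'') (nvar s' ''best'')"
    then have best: "is_arg_max (weight r) (\<lambda>x. x \<in> ?A) (nvar s' ''best'')"
      unfolding heaviest_or_default_weights_stored[OF pre(2) A_subset]
      by (simp only: heaviest_or_default_def nonempty if_False)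
    then have "nvar s' ''best'' < n" "nvar s' ''best'' \<notin> E"
      using A_subset by (auto simp: is_arg_max_def)
    moreover have "heaviest_subset (weight r) (fst \<H> - B) (insert (nvar s' ''best'') E)"
      using heaviest(1) best by (rule heaviest_subset_insert)
    ultimately show
      "halts rounds (NStore ''centers'' (NVar ''best'') (NConst 1)) s' (filled_up r B (Suc q))"
      using heaviest(2) chosen \<open>finite E\<close>
      by (intro halts_intros) (auto simp: filled_up_def eq_exceptD[OF frame])
  qed (use pre(1) rounds_n A_subset in \<open>simp_all add: inputs_def\<close>)
qed

lemma fill_correct:
  assumes pre: "inputs s" "weights_stored r s" "nvar s ''size'' = card (support n (narr s ''centers''))"
  defines "B \<equiv> support n (narr s ''centers'')"
  shows "halts rounds fill_com s (filled_up r B (k - card B))"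
proof -
  let ?s = "set_nvar ''missing'' (k - card B) s"
  have "halts rounds (For ''q'' ''missing'' add_center_com) ?s (filled_up r B (k - card B))"
  proof (rule halts_For[where N = "k - card B" and I = "filled_up r B"])
    show "filled_up r B 0 ?s" by (auto simp: filled_up_def B_def intro: heaviest_subset_empty)
  next
    fix q s' assume q_less: "q < k - card B" and filled: "filled_up r B q s'"
      and frame: "eq_except (written (For ''q'' ''missing'' add_center_com)) ?s s'"
    have "inputs s'" by (rule inputs_frame[OF pre(1) eq_except_set_nvar[OF frame]]) simp
    moreover have "weights_stored r s'"
      using pre(2) by (simp add: weights_stored_def eq_exceptD[OF frame])
    ultimately show "halts rounds add_center_com s' (filled_up r B (Suc q))"
      using q_less filled by (intro add_center_correct) (simp_all add: B_def)
  qed (use rounds_missing k_le_card_X in \<open>auto simp: filled_up_def\<close>)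
  then show ?thesis unfolding fill_com_def
    using pre(1,3) by (intro halts_Seq halts_NAssign) (simp add: inputs_def B_def)
qed

lemma label_correct:
  assumes pre: "inputs s" "rvar s ''radius'' = r"
  defines "kept \<equiv> retained r (support n (narr s ''centers''))"
  shows "halts rounds label_com s (\<lambda>s'. nvar s' ''changed'' = card ({..<n} - kept) \<and>
    (\<forall>x<n. narr s' ''label'' x = (if x \<in> kept then snd \<H> x else narr s ''center'' (narr s ''rep'' x))))"
proof -
  let ?p = "BAnd (Marked ''centers'' (NArr ''lH'' (NVar ''i'')))
    (RLe (Dist ''i'' (NArr ''lH'' (NVar ''i''))) (RVar ''radius''))"
  let ?c = "Cond ?p (NStore ''label'' (NVar ''i'') (NArr ''lH'' (NVar ''i'')))
    (NStore ''label'' (NVar ''i'') (NArr ''center'' (NArr ''rep'' (NVar ''i''))) ;; Incr ''changed'')"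
  let ?s = "set_nvar ''changed'' 0 s"
  define I where "I i s' \<longleftrightarrow> nvar s' ''changed'' = card ({..<i} - kept) \<and>
    (\<forall>x<i. narr s' ''label'' x = (if x \<in> kept then snd \<H> x else narr s ''center'' (narr s ''rep'' x)))"
    for i and s' :: store
  have "halts rounds (For ''i'' ''n'' ?c) ?s (I n)"
  proof (rule halts_For[where N = n and I = I])
    fix i s' assume loop: "i < n" "nvar s' ''i'' = i" and inv: "I i s'"
      and frame: "eq_except (written (For ''i'' ''n'' ?c)) ?s s'"
    have inputs: "inputs s'" by (rule inputs_frame[OF pre(1) eq_except_set_nvar[OF frame]]) simp
    have label: "narr s' ''lH'' i = snd \<H> i" "snd \<H> i < n"
      and dist: "rarr s' ''d'' (narr s' ''row'' i + snd \<H> i) = D i (snd \<H> i)"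
      using inputs loop label_in_X[of i] by (auto simp: inputs_def)
    have same: "rvar s' ''radius'' = r" "narr s' ''center'' = narr s ''center''"
      "narr s' ''rep'' = narr s ''rep''" "narr s' ''centers'' = narr s ''centers''"
      using pre by (simp_all add: eq_exceptD[OF frame])
    have test: "bval ?p s' \<longleftrightarrow> i \<in> kept"
      using loop label dist same by (auto simp: kept_def retained_def in_support)
    have "{..<Suc i} - kept = (if i \<in> kept then {..<i} - kept else insert i ({..<i} - kept))"
      by (auto simp: less_Suc_eq)
    then have "card ({..<Suc i} - kept) = card ({..<i} - kept) + (if i \<in> kept then 0 else 1)"
      by simp
    then show "halts rounds ?c s' (I (Suc i))"
      using inv loop label same test by (intro halts_intros) (auto simp: I_def less_Suc_eq)
  qed (use pre rounds_n in \<open>simp_all add: I_def inputs_def\<close>)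
  then show ?thesis unfolding label_com_def I_def by (intro halts_Seq halts_NAssign) simp
qed

lemma prepare_correct:
  assumes pre: "inputs s" "rvar s ''radius'' = r" "0 \<le> r"
  shows "halts rounds prepare_com s
    (\<lambda>s'. net_stored r s' \<and> weights_stored r s' \<and> support n (narr s' ''centers'') = {})"
  unfolding prepare_com_def
proof (rule halts_Seq_conseq[OF reset_correct[OF pre(1)]])
  fix s\<^sub>1 assume frame: "eq_except (written reset_com) s s\<^sub>1"
    and reset: "support n (narr s\<^sub>1 ''net'') = {} \<and> support n (narr s\<^sub>1 ''covered'') = {} \<and>
      support n (narr s\<^sub>1 ''centers'') = {} \<and> support n (narr s\<^sub>1 ''weight'') = {}"
  have inputs: "inputs s\<^sub>1" by (rule inputs_frame[OF pre(1) frame]) simp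
  have radius: "rvar s\<^sub>1 ''radius'' = r" using pre(2) by (simp add: eq_exceptD[OF frame])
  have "halts rounds net_com s\<^sub>1 (net_stored r)"
    using inputs radius pre(3) reset by (intro net_correct) auto
  then show "halts rounds (net_com ;; weights_com) s\<^sub>1
      (\<lambda>s'. net_stored r s' \<and> weights_stored r s' \<and> support n (narr s' ''centers'') = {})"
  proof (rule halts_Seq_conseq)
    fix s\<^sub>2 assume frame: "eq_except (written net_com) s\<^sub>1 s\<^sub>2" and net: "net_stored r s\<^sub>2"
    have "inputs s\<^sub>2" by (rule inputs_frame[OF inputs frame]) simp
    moreover have same: "rvar s\<^sub>2 ''radius'' = r" "narr s\<^sub>2 ''weight'' = narr s\<^sub>1 ''weight''"
      "narr s\<^sub>2 ''centers'' = narr s\<^sub>1 ''centers''"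
      using radius by (simp_all add: eq_exceptD[OF frame])
    ultimately have "halts rounds weights_com s\<^sub>2 (weights_stored r)"
      using reset by (intro weights_correct) auto
    then show "halts rounds weights_com s\<^sub>2
      (\<lambda>s'. net_stored r s' \<and> weights_stored r s' \<and> support n (narr s' ''centers'') = {})"
      by (rule halts_conseq) (use net reset same in \<open>auto simp: net_stored_def eq_exceptD\<close>)
  qed
qed

lemma select_correct:
  assumes pre: "inputs s" "rvar s ''radius'' = r" "0 \<le> r"
  shows "halts rounds select_com s (\<lambda>s'. net_stored r s' \<and>
    selection r (support n (narr s' ''net'')) (narr s' ''center'') (support n (narr s' ''centers'')))"
  (is "halts _ _ _ ?Q")
  unfolding select_com_def
proof (rule halts_Seq_conseq[OF prepare_correct[OF pre]], elim conjE)
  fix s\<^sub>1 assume frame: "eq_except (written prepare_com) s s\<^sub>1"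
    and net: "net_stored r s\<^sub>1" and weights: "weights_stored r s\<^sub>1"
    and no_centers: "support n (narr s\<^sub>1 ''centers'') = {}"
  let ?S = "support n (narr s\<^sub>1 ''net'')"
  have inputs: "inputs s\<^sub>1" by (rule inputs_frame[OF pre(1) frame]) simp
  have radius: "rvar s\<^sub>1 ''radius'' = r" using pre(2) by (simp add: eq_exceptD[OF frame])
  show "halts rounds (centers_com ;; fill_com) s\<^sub>1 ?Q"
  proof (rule halts_Seq_conseq[OF centers_correct[OF inputs radius weights pre(3) no_centers]])
    fix s\<^sub>2 assume frame: "eq_except (written centers_com) s\<^sub>1 s\<^sub>2"
      and centers: "centers_stored r ?S s\<^sub>2"
    let ?B = "support n (narr s\<^sub>2 ''centers'')"
    have inputs: "inputs s\<^sub>2" by (rule inputs_frame[OF inputs frame]) simp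
    have same: "nvar s\<^sub>2 ''size'' = nvar s\<^sub>1 ''size''" "narr s\<^sub>2 ''net'' = narr s\<^sub>1 ''net''"
      "narr s\<^sub>2 ''rep'' = narr s\<^sub>1 ''rep''"
      and weights: "weights_stored r s\<^sub>2"
      using weights by (simp_all add: weights_stored_def eq_exceptD[OF frame])
    have sep: "separated r ?S" using net by (simp add: net_stored_def net_def)
    have cen_near: "narr s\<^sub>2 ''center'' x \<in> {..<n} \<and> D x (narr s\<^sub>2 ''center'' x) \<le> r" if "x \<in> ?S"
      for x
      using best_centers_of_separated_near[OF sep that _ pre(3)] centers that
      by (simp add: centers_stored_def)
    have card_eq: "card ?B = card ?S"
      using centers separated_inj_on[OF sep cen_near] by (simp add: centers_stored_def card_image)
    then have "nvar s\<^sub>2 ''size'' = card ?B" using same net by (simp add: net_stored_def)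
    from fill_correct[OF inputs weights this] show "halts rounds fill_com s\<^sub>2 ?Q"
    proof (rule halts_conseq)
      fix s\<^sub>3 assume frame: "eq_except (written fill_com) s\<^sub>2 s\<^sub>3"
        and "filled_up r ?B (k - card ?B) s\<^sub>3"
      then have "selection r ?S (narr s\<^sub>3 ''center'') (support n (narr s\<^sub>3 ''centers''))"
        using centers card_eq
        by (auto simp: filled_up_def selection_def centers_stored_def eq_exceptD[OF frame])
      then show "?Q s\<^sub>3" using net same by (simp add: net_stored_def eq_exceptD[OF frame])
    qed
  qed
qed

definition solution :: "real \<Rightarrow> (nat \<Rightarrow> nat) \<Rightarrow> (nat \<Rightarrow> nat) \<Rightarrow> bool" where
  "solution c C l \<longleftrightarrow> lc_feasible {..<n} k b \<H> (support n C, l) \<and> cost_inf {..<n} D (support n C, l) \<le> c"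

lemma solution_cong:
  assumes "\<And>i. i < n \<Longrightarrow> C i = C' i" "\<And>i. i < n \<Longrightarrow> l i = l' i"
  shows "solution c C l \<longleftrightarrow> solution c C' l'"
proof -
  have "support n C = support n C'" using assms(1) by (auto simp: support_def)
  moreover have "{i \<in> {..<n}. snd \<H> i \<noteq> l i} = {i \<in> {..<n}. snd \<H> i \<noteq> l' i}" using assms(2) by auto
  ultimately show ?thesis
    using assms(2)
    by (auto simp: solution_def lc_feasible_def is_clustering_def label_diff_def cost_inf_le_iff
        Pi_iff)
qed

definition verdict :: "real \<Rightarrow> store \<Rightarrow> bool" where
  "verdict r s \<longleftrightarrow> (if nvar s ''size'' \<le> k \<and> nvar s ''changed'' \<le> b
     then solution (3 * r) (narr s ''centers'') (narr s ''label'') else r < lc_opt {..<n} D k b \<H>)"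

lemma check_correct:
  assumes pre: "inputs s" "rvar s ''radius'' = r" "0 \<le> r"
  shows "halts rounds check_com s (verdict r)"
  unfolding check_com_def
proof (rule halts_Seq_conseq[OF select_correct[OF pre]], elim conjE)
  fix s\<^sub>1 assume frame: "eq_except (written select_com) s s\<^sub>1" and net: "net_stored r s\<^sub>1"
    and sel: "selection r (support n (narr s\<^sub>1 ''net'')) (narr s\<^sub>1 ''center'')
      (support n (narr s\<^sub>1 ''centers''))"
  let ?S = "support n (narr s\<^sub>1 ''net'')" and ?C = "support n (narr s\<^sub>1 ''centers'')"
  have net: "net r ?S (narr s\<^sub>1 ''rep'')" and count: "nvar s\<^sub>1 ''size'' = card ?S"
    using net by (auto simp: net_stored_def)
  then have sep: "separated r ?S" by (simp add: net_def)
  have "inputs s\<^sub>1" by (rule inputs_frame[OF pre(1) frame]) simp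
  moreover have "rvar s\<^sub>1 ''radius'' = r" using pre(2) by (simp add: eq_exceptD[OF frame])
  ultimately show "halts rounds label_com s\<^sub>1 (verdict r)"
  proof (rule halts_conseq[OF label_correct], elim conjE)
    fix s\<^sub>2 assume frame: "eq_except (written label_com) s\<^sub>1 s\<^sub>2"
      and relabelled: "nvar s\<^sub>2 ''changed'' = card ({..<n} - retained r ?C)"
      and labels: "\<forall>x<n. narr s\<^sub>2 ''label'' x =
        (if x \<in> retained r ?C then snd \<H> x else narr s\<^sub>1 ''center'' (narr s\<^sub>1 ''rep'' x))"
    have same: "nvar s\<^sub>2 ''size'' = card ?S" "narr s\<^sub>2 ''centers'' = narr s\<^sub>1 ''centers''"
      using count by (simp_all add: eq_exceptD[OF frame])
    show "verdict r s\<^sub>2"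
      using selection_sound[OF pre(3) net sel, of "narr s\<^sub>2 ''label''"]
        selection_complete[OF pre(3) sep sel] labels relabelled
      by (auto simp: verdict_def solution_def same not_less[symmetric])
  qed
qed

end

section \<open>Binary search over the distances\<close>

definition rows_com :: com where
  "rows_com = NAssign ''N'' (NConst 0) ;; For ''i'' ''n''
     (NStore ''row'' (NVar ''i'') (NVar ''N'') ;; NAssign ''N'' (NPlus (NVar ''N'') (NVar ''n'')))"

definition output_com :: com where
  "output_com = For ''i'' ''n''
     (NStore ''C'' (NVar ''i'') (NArr ''centers'' (NVar ''i'')) ;;
      NStore ''lC'' (NVar ''i'') (NArr ''label'' (NVar ''i'')))"

definition bisect_com :: com where
  "bisect_com = check_com ;;
     Cond (BAnd (NLe (NVar ''size'') (NVar ''k'')) (NLe (NVar ''changed'') (NVar ''b'')))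
       (NAssign ''hi'' (NVar ''mid'') ;; output_com)
       (NAssign ''lo'' (NPlus (NVar ''mid'') (NConst 1)))"

definition probe_com :: com where
  "probe_com =
     NAssign ''mid'' (NHalf (NPlus (NVar ''lo'') (NVar ''hi''))) ;;
     RAssign ''radius'' (RArr ''values'' (NVar ''mid'')) ;; bisect_com"

definition search_com :: com where
  "search_com = NAssign ''lo'' (NConst 0) ;; NAssign ''hi'' (NVar ''N'') ;;
     Loop (NLess (NVar ''lo'') (NVar ''hi'')) probe_com"

definition cluster_com :: com where
  "cluster_com = rows_com ;; copy_array_com ''d'' ''values'' ;; sort_com ;; search_com"

lemma written_rows [simp]: "written rows_com = {NatVar ''i'', NatVar ''N'', NatArr ''row''}"
  by (auto simp: rows_com_def)

lemma written_output [simp]: "written output_com = {NatVar ''i'', NatArr ''C'', NatArr ''lC''}"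
  by (auto simp: output_com_def)

lemma written_probe [simp]:
  "written probe_com = written check_com \<union>
     {NatVar ''mid'', NatVar ''lo'', NatVar ''hi'', RealVar ''radius'', NatArr ''C'', NatArr ''lC''}"
  by (auto simp: probe_com_def bisect_com_def)

lemma rows_correct:
  assumes pre: "nvar s ''n'' = n" "n \<le> rounds (NLess (NVar ''i'') (NVar ''n''))"
  shows "halts rounds rows_com s (\<lambda>s'. nvar s' ''N'' = n * n \<and> (\<forall>i<n. narr s' ''row'' i = i * n))"
proof -
  let ?c = "NStore ''row'' (NVar ''i'') (NVar ''N'') ;; NAssign ''N'' (NPlus (NVar ''N'') (NVar ''n''))"
  let ?s = "set_nvar ''N'' 0 s"
  have "halts rounds (For ''i'' ''n'' ?c) ?s (\<lambda>s'. nvar s' ''N'' = n * n \<and>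
    (\<forall>i<n. narr s' ''row'' i = i * n))"
  proof (rule halts_For[where N = n and
        I = "\<lambda>j s'. nvar s' ''N'' = j * n \<and> (\<forall>i<j. narr s' ''row'' i = i * n)"])
    fix j s' assume "nvar s' ''i'' = j" "nvar s' ''N'' = j * n \<and> (\<forall>i<j. narr s' ''row'' i = i * n)"
      and frame: "eq_except (written (For ''i'' ''n'' ?c)) ?s s'"
    moreover have "nvar s' ''n'' = n" using pre by (simp add: eq_exceptD[OF frame])
    ultimately show "halts rounds ?c s' (\<lambda>s'. nvar s' ''N'' = Suc j * n \<and>
      (\<forall>i<Suc j. narr s' ''row'' i = i * n))"
      by (intro halts_intros) (auto simp: less_Suc_eq)
  qed (use pre in simp_all)
  then show ?thesis unfolding rows_com_def by (intro halts_Seq halts_NAssign) simp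
qed

lemma row_major_less:
  fixes n :: nat
  assumes "i < n" "j < n"
  shows "i * n + j < n * n"
proof -
  have "i * n + j < Suc i * n" using assms(2) by simp
  also have "\<dots> \<le> n * n" using assms(1) by (intro mult_le_mono1) simp
  finally show ?thesis .
qed

lemma image_row_major:
  fixes n :: nat
  assumes "\<And>i j. i < n \<Longrightarrow> j < n \<Longrightarrow> g (i * n + j) = D i j"
  shows "g ` {..<n * n} = (\<lambda>(i, j). D i j) ` ({..<n} \<times> {..<n})"
proof (intro equalityI subsetI)
  fix y assume "y \<in> g ` {..<n * n}"
  then obtain x where index: "x < n * n" "y = g x" by blast
  then have "0 < n" by (cases n) auto
  then have "x div n < n" "x mod n < n" using index(1) by (simp_all add: less_mult_imp_div_less)
  then show "y \<in> (\<lambda>(i, j). D i j) ` ({..<n} \<times> {..<n})"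
    using assms[of "x div n" "x mod n"] index(2) by force
next
  fix y assume "y \<in> (\<lambda>(i, j). D i j) ` ({..<n} \<times> {..<n})"
  then obtain i j where i_j: "i < n" "j < n" "y = D i j" by auto
  then show "y \<in> g ` {..<n * n}" using assms[OF i_j(1,2)] row_major_less[OF i_j(1,2)] by force
qed

context indexed_instance
begin

lemma output_correct:
  assumes pre: "nvar s ''n'' = n"
  shows "halts rounds output_com s
    (\<lambda>s'. \<forall>i<n. narr s' ''C'' i = narr s ''centers'' i \<and> narr s' ''lC'' i = narr s ''label'' i)"
  unfolding output_com_def
proof (rule halts_For[where N = n and
      I = "\<lambda>j s'. \<forall>i<j. narr s' ''C'' i = narr s ''centers'' i \<and>
        narr s' ''lC'' i = narr s ''label'' i"])
  let ?c = "NStore ''C'' (NVar ''i'') (NArr ''centers'' (NVar ''i'')) ;;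
    NStore ''lC'' (NVar ''i'') (NArr ''label'' (NVar ''i''))"
  fix j s' assume "nvar s' ''i'' = j"
    and "\<forall>i<j. narr s' ''C'' i = narr s ''centers'' i \<and> narr s' ''lC'' i = narr s ''label'' i"
    and frame: "eq_except (written (For ''i'' ''n'' ?c)) s s'"
  then show "halts rounds ?c s'
      (\<lambda>s'. \<forall>i<Suc j. narr s' ''C'' i = narr s ''centers'' i \<and> narr s' ''lC'' i = narr s ''label'' i)"
    by (intro halts_intros) (auto simp: less_Suc_eq eq_exceptD[OF frame])
qed (use pre rounds_n in simp_all)

definition bisected :: "real \<Rightarrow> nat \<Rightarrow> store \<Rightarrow> store \<Rightarrow> bool" where
  "bisected r mid s s' \<longleftrightarrow>
     nvar s' ''lo'' = nvar s ''lo'' \<and> nvar s' ''hi'' = mid \<and>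
       solution (3 * r) (narr s' ''C'') (narr s' ''lC'') \<or>
     nvar s' ''lo'' = mid + 1 \<and> nvar s' ''hi'' = nvar s ''hi'' \<and> narr s' ''C'' = narr s ''C'' \<and>
       narr s' ''lC'' = narr s ''lC'' \<and> r < lc_opt {..<n} D k b \<H>"

lemma bisect_correct:
  assumes pre: "inputs s" "rvar s ''radius'' = r" "0 \<le> r"
  shows "halts rounds bisect_com s (bisected r (nvar s ''mid'') s)"
  unfolding bisect_com_def
proof (rule halts_Seq_conseq[OF check_correct[OF pre]])
  let ?accept = "BAnd (NLe (NVar ''size'') (NVar ''k'')) (NLe (NVar ''changed'') (NVar ''b''))"
  let ?Q = "bisected r (nvar s ''mid'') s"
  fix s' assume frame: "eq_except (written check_com) s s'" and verdict: "verdict r s'"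
  have same: "nvar s' ''lo'' = nvar s ''lo''" "nvar s' ''hi'' = nvar s ''hi''"
    "nvar s' ''mid'' = nvar s ''mid''" "narr s' ''C'' = narr s ''C''"
    "narr s' ''lC'' = narr s ''lC''"
    by (simp_all add: eq_exceptD[OF frame])
  have "inputs s'" by (rule inputs_frame[OF pre(1) frame]) simp
  then have inputs': "nvar s' ''n'' = n" "nvar s' ''k'' = k" "nvar s' ''b'' = b"
    by (simp_all add: inputs_def)
  show "halts rounds (Cond ?accept (NAssign ''hi'' (NVar ''mid'') ;; output_com)
      (NAssign ''lo'' (NPlus (NVar ''mid'') (NConst 1)))) s' ?Q"
  proof (rule halts_Cond)
    let ?s = "set_nvar ''hi'' (nvar s ''mid'') s'"
    assume "bval ?accept s'"
    then have found: "solution (3 * r) (narr s' ''centers'') (narr s' ''label'')"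
      using verdict inputs' by (simp add: verdict_def)
    have "halts rounds output_com ?s ?Q"
    proof (rule halts_conseq[OF output_correct])
      fix s'' assume frame: "eq_except (written output_com) ?s s''"
        and "\<forall>i<n. narr s'' ''C'' i = narr ?s ''centers'' i \<and> narr s'' ''lC'' i = narr ?s ''label'' i"
      then have "solution (3 * r) (narr s'' ''C'') (narr s'' ''lC'')"
        using found solution_cong[of "narr s'' ''C''" "narr s' ''centers''" "narr s'' ''lC''"
          "narr s' ''label''"] by simp
      then show "?Q s''" using same by (simp add: bisected_def eq_exceptD[OF frame])
    qed (use inputs' in simp)
    then show "halts rounds (NAssign ''hi'' (NVar ''mid'') ;; output_com) s' ?Q"
      using same by (intro halts_Seq halts_NAssign) simp
  next
    assume "\<not> bval ?accept s'"
    then have "r < lc_opt {..<n} D k b \<H>"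
      using verdict inputs' by (simp add: verdict_def split: if_splits)
    then show "halts rounds (NAssign ''lo'' (NPlus (NVar ''mid'') (NConst 1))) s' ?Q"
      using same by (intro halts_NAssign) (simp add: bisected_def)
  qed
qed

lemma probe_correct:
  assumes "inputs s" "mid = (nvar s ''lo'' + nvar s ''hi'') div 2" "0 \<le> rarr s ''values'' mid"
  shows "halts rounds probe_com s (bisected (rarr s ''values'' mid) mid s)"
proof -
  let ?r = "rarr s ''values'' mid"
  let ?s = "s\<lparr>nvar := (nvar s)(''mid'' := mid), rvar := (rvar s)(''radius'' := ?r)\<rparr>"
  have "inputs ?s" using assms(1) by (simp add: inputs_def)
  moreover have "bisected ?r mid ?s = bisected ?r mid s" by (simp add: bisected_def fun_eq_iff)
  ultimately show ?thesis unfolding probe_com_def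
    using bisect_correct[of ?s ?r] assms(2,3) by (intro halts_Seq halts_NAssign halts_RAssign) simp
qed

text \<open>
  An accepted radius may be smaller than the optimal cost, and acceptance need not be monotone in
  the radius; so the search keeps the solution that was found for the upper end of its interval.
\<close>

definition search_invariant :: "(nat \<Rightarrow> real) \<Rightarrow> nat \<Rightarrow> nat \<Rightarrow> store \<Rightarrow> bool" where
  "search_invariant A N q s \<longleftrightarrow> nvar s ''lo'' \<le> nvar s ''hi'' \<and> nvar s ''hi'' \<le> N \<and>
     nvar s ''hi'' - nvar s ''lo'' < 2 ^ q \<and> (\<forall>i < nvar s ''lo''. A i < lc_opt {..<n} D k b \<H>) \<and>
     (nvar s ''hi'' < N \<longrightarrow> solution (3 * A (nvar s ''hi'')) (narr s ''C'') (narr s ''lC''))"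

lemma probe_search_invariant:
  assumes pre: "inputs s" "rarr s ''values'' = A"
    and sorted: "mono_on {..<N} A" "\<And>i. i < N \<Longrightarrow> 0 \<le> A i"
    and inv: "search_invariant A N (Suc q) s" and nonempty: "nvar s ''lo'' < nvar s ''hi''"
  shows "halts rounds probe_com s (search_invariant A N q)"
proof -
  let ?lo = "nvar s ''lo''" and ?hi = "nvar s ''hi''"
  let ?mid = "(?lo + ?hi) div 2"
  have mid: "?lo \<le> ?mid" "?mid < ?hi" "?mid < N" "?mid - ?lo < 2 ^ q" "?hi - (?mid + 1) < 2 ^ q"
    using inv nonempty by (auto simp: search_invariant_def)
  show ?thesis
  proof (rule halts_conseq[OF probe_correct[OF pre(1) refl]])
    show "0 \<le> rarr s ''values'' ?mid" using sorted(2) pre(2) mid(3) by simp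
  next
    fix s' assume "bisected (rarr s ''values'' ?mid) ?mid s s'"
    then consider
        (accepted) "nvar s' ''lo'' = ?lo" "nvar s' ''hi'' = ?mid"
          "solution (3 * A ?mid) (narr s' ''C'') (narr s' ''lC'')"
      | (rejected) "nvar s' ''lo'' = ?mid + 1" "nvar s' ''hi'' = ?hi" "narr s' ''C'' = narr s ''C''"
          "narr s' ''lC'' = narr s ''lC''" "A ?mid < lc_opt {..<n} D k b \<H>"
      using pre(2) by (auto simp: bisected_def)
    then show "search_invariant A N q s'"
    proof cases
      case accepted
      then show ?thesis using inv mid by (simp add: search_invariant_def)
    next
      case rejected
      have "A i \<le> A ?mid" if "i < ?mid + 1" for i
        using that mid(3) by (intro mono_onD[OF sorted(1)]) auto
      then have "\<forall>i<?mid + 1. A i < lc_opt {..<n} D k b \<H>"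
        using rejected(5) by (meson le_less_trans)
      then show ?thesis using inv mid rejected by (simp add: search_invariant_def)
    qed
  qed
qed

lemma search_correct:
  assumes pre: "inputs s" "nvar s ''N'' = N" "rarr s ''values'' = A"
    and distances: "mono_on {..<N} A" "\<And>i. i < N \<Longrightarrow> 0 \<le> A i" "lc_opt {..<n} D k b \<H> \<in> A ` {..<N}"
    and limit: "N < 2 ^ rounds (NLess (NVar ''lo'') (NVar ''hi''))"
  shows "halts rounds search_com s
    (\<lambda>s'. solution (3 * lc_opt {..<n} D k b \<H>) (narr s' ''C'') (narr s' ''lC''))"
proof -
  let ?opt = "lc_opt {..<n} D k b \<H>"
  let ?s = "set_nvar ''hi'' N (set_nvar ''lo'' 0 s)"
  have "halts rounds (Loop (NLess (NVar ''lo'') (NVar ''hi'')) probe_com) ?s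
    (\<lambda>s'. solution (3 * ?opt) (narr s' ''C'') (narr s' ''lC''))"
  proof (rule halts_Loop[where I = "search_invariant A N", OF _ order_refl])
    fix q s' assume "search_invariant A N (Suc q) s'" "bval (NLess (NVar ''lo'') (NVar ''hi'')) s'"
      and frame: "eq_except (written probe_com) ?s s'"
    moreover have "inputs s'"
      by (rule inputs_frame[OF pre(1) eq_except_set_nvar[OF eq_except_set_nvar[OF frame]]]) simp
    moreover have "rarr s' ''values'' = A" using pre(3) by (simp add: eq_exceptD[OF frame])
    ultimately show "halts rounds probe_com s' (search_invariant A N q)"
      using distances(1,2) by (intro probe_search_invariant) auto
  next
    fix q s' assume inv: "search_invariant A N q s'"
      and "\<not> bval (NLess (NVar ''lo'') (NVar ''hi'')) s'"
    then have lo_hi: "nvar s' ''lo'' = nvar s' ''hi''" by (simp add: search_invariant_def)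
    obtain i where opt_index: "i < N" "?opt = A i" using distances(3) by auto
    then have "nvar s' ''hi'' \<le> i"
      using inv lo_hi by (force simp: search_invariant_def not_less[symmetric])
    then have "A (nvar s' ''hi'') \<le> ?opt" "nvar s' ''hi'' < N"
      using opt_index mono_onD[OF distances(1), of "nvar s' ''hi''" i] by auto
    then show "solution (3 * ?opt) (narr s' ''C'') (narr s' ''lC'')"
      using inv by (auto simp: search_invariant_def solution_def)
  qed (use limit in \<open>auto simp: search_invariant_def\<close>)
  then show ?thesis unfolding search_com_def using pre(2) by (intro halts_Seq halts_NAssign) simp
qed

lemma cluster_correct:
  assumes pre: "nvar s ''n'' = n" "nvar s ''k'' = k" "nvar s ''b'' = b"
    "support n (narr s ''H'') = fst \<H>" "\<And>i. i < n \<Longrightarrow> narr s ''lH'' i = snd \<H> i"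
    "\<And>i j. i < n \<Longrightarrow> j < n \<Longrightarrow> rarr s ''d'' (i * n + j) = D i j"
    and rounds: "n * n \<le> rounds (NLess (NVar ''out'') (NVar ''N''))"
      "n * n < 2 ^ rounds (NLess (NVar ''width'') (NVar ''N''))"
      "n * n < 2 ^ rounds (NLess (NVar ''lo'') (NVar ''hi''))"
  shows "halts rounds cluster_com s
    (\<lambda>s'. solution (3 * lc_opt {..<n} D k b \<H>) (narr s' ''C'') (narr s' ''lC''))" (is "halts _ _ _ ?Q")
  unfolding cluster_com_def
proof (rule halts_Seq_conseq[OF rows_correct[where rounds = rounds, OF pre(1) rounds_n]], elim conjE)
  fix s\<^sub>1 assume frame: "eq_except (written rows_com) s s\<^sub>1"
    and N: "nvar s\<^sub>1 ''N'' = n * n" and row: "\<forall>i<n. narr s\<^sub>1 ''row'' i = i * n"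
  have inputs: "inputs s\<^sub>1" using pre row by (simp add: inputs_def eq_exceptD[OF frame])
  have d_eq: "rarr s\<^sub>1 ''d'' = rarr s ''d''" by (simp add: eq_exceptD[OF frame])
  show "halts rounds (copy_array_com ''d'' ''values'' ;; sort_com ;; search_com) s\<^sub>1 ?Q"
  proof (rule halts_Seq_conseq[OF copy_array_correct[where rounds = rounds, OF N rounds(1)]])
    fix s\<^sub>2 assume frame: "eq_except (written (copy_array_com ''d'' ''values'')) s\<^sub>1 s\<^sub>2"
      and "\<forall>i<n * n. rarr s\<^sub>2 ''values'' i = rarr s\<^sub>1 ''d'' i"
    then have entries: "rarr s\<^sub>2 ''values'' ` {..<n * n} = rarr s ''d'' ` {..<n * n}"
      using d_eq by (intro image_cong) auto
    have inputs: "inputs s\<^sub>2" by (rule inputs_frame[OF inputs frame]) simp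
    have N: "nvar s\<^sub>2 ''N'' = n * n" using N by (simp add: eq_exceptD[OF frame])
    show "halts rounds (sort_com ;; search_com) s\<^sub>2 ?Q"
    proof (rule halts_Seq_conseq[OF sort_correct[where rounds = rounds, OF N rounds(1)
            less_imp_le[OF rounds(2)]]], elim conjE)
      fix s\<^sub>3 assume frame: "eq_except (written sort_com) s\<^sub>2 s\<^sub>3"
        and sorted: "mono_on {..<n * n} (rarr s\<^sub>3 ''values'')"
        and "rarr s\<^sub>3 ''values'' ` {..<n * n} = rarr s\<^sub>2 ''values'' ` {..<n * n}"
      then have distances: "rarr s\<^sub>3 ''values'' ` {..<n * n} = (\<lambda>(i, j). D i j) ` ({..<n} \<times> {..<n})"
        using entries image_row_major[of n "rarr s ''d''" D] pre(6) by simp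
      have "inputs s\<^sub>3" by (rule inputs_frame[OF inputs frame]) simp
      moreover have "nvar s\<^sub>3 ''N'' = n * n" using N by (simp add: eq_exceptD[OF frame])
      moreover have "lc_opt {..<n} D k b \<H> \<in> rarr s\<^sub>3 ''values'' ` {..<n * n}"
        using lc_opt_is_distance unfolding distances .
      moreover have "0 \<le> rarr s\<^sub>3 ''values'' x" if "x < n * n" for x
      proof -
        have "rarr s\<^sub>3 ''values'' x \<in> (\<lambda>(i, j). D i j) ` ({..<n} \<times> {..<n})"
          unfolding distances[symmetric] using that by blast
        then show ?thesis by auto
      qed
      ultimately show "halts rounds search_com s\<^sub>3 ?Q"
        using sorted rounds(3) by (intro search_correct) auto
    qed
  qed simp
qed

end

section \<open>Transport along the enumeration of the points\<close>

definition corresponds :: "'b set \<Rightarrow> ('b \<Rightarrow> 'a) \<Rightarrow> 'b clustering \<Rightarrow> 'a clustering \<Rightarrow> bool" where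
  "corresponds Y f \<C> \<C>' \<longleftrightarrow> fst \<C> \<subseteq> Y \<and> snd \<C> \<in> Y \<rightarrow> Y \<and>
     fst \<C>' = f ` fst \<C> \<and> (\<forall>y\<in>Y. snd \<C>' (f y) = f (snd \<C> y))"

lemma is_clustering_corresponds:
  assumes bij: "bij_betw f Y X" and corr: "corresponds Y f \<C> \<C>'"
  shows "is_clustering X k \<C>' \<longleftrightarrow> is_clustering Y k \<C>"
proof -
  have inj: "inj_on f Y" and X_eq: "X = f ` Y" using bij by (auto simp: bij_betw_def)
  have "f (snd \<C> y) \<in> f ` fst \<C> \<longleftrightarrow> snd \<C> y \<in> fst \<C>" if "y \<in> Y" for y
    using corr that inj by (intro inj_on_image_mem_iff) (auto simp: corresponds_def)
  moreover have "card (f ` fst \<C>) = card (fst \<C>)"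
    using corr inj by (intro card_image) (auto simp: corresponds_def intro: inj_on_subset)
  ultimately show ?thesis using corr by (auto simp: is_clustering_def corresponds_def X_eq Pi_iff)
qed

lemma label_diff_corresponds:
  assumes bij: "bij_betw f Y X" and corr: "corresponds Y f \<C> \<C>'" "corresponds Y f \<D> \<D>'"
  shows "label_diff X \<C>' \<D>' = label_diff Y \<C> \<D>"
proof -
  have inj: "inj_on f Y" and X_eq: "X = f ` Y" using bij by (auto simp: bij_betw_def)
  have "f (snd \<C> y) = f (snd \<D> y) \<longleftrightarrow> snd \<C> y = snd \<D> y" if "y \<in> Y" for y
    using corr that by (intro inj_on_eq_iff[OF inj]) (auto simp: corresponds_def)
  then have "{x \<in> X. snd \<C>' x \<noteq> snd \<D>' x} = f ` {y \<in> Y. snd \<C> y \<noteq> snd \<D> y}"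
    using corr by (auto simp: corresponds_def X_eq)
  then show ?thesis using inj by (auto simp: label_diff_def intro!: card_image intro: inj_on_subset)
qed

lemma lc_feasible_corresponds:
  assumes "bij_betw f Y X" "corresponds Y f \<H> \<H>'" "corresponds Y f \<C> \<C>'"
  shows "lc_feasible X k b \<H>' \<C>' \<longleftrightarrow> lc_feasible Y k b \<H> \<C>"
  using assms by (simp add: lc_feasible_def is_clustering_corresponds label_diff_corresponds)

lemma cost_inf_corresponds:
  assumes "bij_betw f Y X" "corresponds Y f \<C> \<C>'"
  shows "cost_inf X d \<C>' = cost_inf Y (\<lambda>i j. d (f i) (f j)) \<C>"
proof -
  have X_eq: "X = f ` Y" using assms(1) by (simp add: bij_betw_def)
  have "(\<lambda>x. d x (snd \<C>' x)) ` X = (\<lambda>y. d (f y) (f (snd \<C> y))) ` Y"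
    unfolding X_eq image_image using assms(2) by (intro image_cong) (simp_all add: corresponds_def)
  then show ?thesis by (simp add: cost_inf_def)
qed

lemma ex_corresponds:
  assumes bij: "bij_betw f Y X" and clustering: "is_clustering X k \<C>'"
  shows "\<exists>\<C>. corresponds Y f \<C> \<C>'"
proof
  let ?g = "inv_into Y f"
  have image: "f ` Y = X" and C_sub: "fst \<C>' \<subseteq> X" and label: "\<And>x. x \<in> X \<Longrightarrow> snd \<C>' x \<in> X"
    using bij clustering by (auto simp: bij_betw_def is_clustering_def)
  have inverse: "?g x \<in> Y" "f (?g x) = x" if "x \<in> X" for x
    using that image by (auto intro: inv_into_into f_inv_into_f)
  have "f ` ?g ` fst \<C>' = fst \<C>'" using image C_sub by (rule image_inv_into_cancel)
  then show "corresponds Y f (?g ` fst \<C>', \<lambda>y. ?g (snd \<C>' (f y))) \<C>'"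
    using C_sub label inverse image unfolding corresponds_def by auto
qed

lemma Metric_space_pullback:
  assumes bij: "bij_betw f Y X" and metric: "Metric_space X d"
  shows "Metric_space Y (\<lambda>i j. d (f i) (f j))"
proof -
  interpret Metric_space X d by (rule metric)
  have "f y \<in> X" if "y \<in> Y" for y using bij that by (auto simp: bij_betw_def)
  moreover have "f y = f z \<longleftrightarrow> y = z" if "y \<in> Y" "z \<in> Y" for y z
    using bij that by (auto simp: bij_betw_def inj_on_eq_iff)
  ultimately show ?thesis by unfold_locales (auto simp: commute triangle)
qed

lemma lc_instance_corresponds:
  assumes "bij_betw f Y X" "corresponds Y f \<H> \<H>'" "lc_instance X d k b \<H>'"
  shows "lc_instance Y (\<lambda>i j. d (f i) (f j)) k b \<H>"
  using assms is_clustering_corresponds[OF assms(1,2)] bij_betw_finite[OF assms(1)]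
  by (simp add: lc_instance_def Metric_space_pullback)

lemma lc_opt_corresponds_le:
  assumes bij: "bij_betw f Y X" and corr: "corresponds Y f \<H> \<H>'" and inst: "lc_instance X d k b \<H>'"
  shows "lc_opt Y (\<lambda>i j. d (f i) (f j)) k b \<H> \<le> lc_opt X d k b \<H>'"
proof -
  obtain \<C>' where optimal: "lc_feasible X k b \<H>' \<C>'" "cost_inf X d \<C>' = lc_opt X d k b \<H>'"
    using lc_opt_attained(1)[OF inst] by blast
  then have "is_clustering X k \<C>'" by (simp add: lc_feasible_def)
  then obtain \<C> where "corresponds Y f \<C> \<C>'" using ex_corresponds[OF bij] by blast
  then have "lc_feasible Y k b \<H> \<C>" "cost_inf Y (\<lambda>i j. d (f i) (f j)) \<C> = lc_opt X d k b \<H>'"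
    using optimal lc_feasible_corresponds[OF bij corr] cost_inf_corresponds[OF bij, of \<C> \<C>' d]
    by auto
  then show ?thesis using lc_opt_attained(2)[OF lc_instance_corresponds[OF bij corr inst]] by metis
qed

lemma index_of:
  assumes bij: "bij_betw pt {..<card X} X" and x_in: "x \<in> X"
  shows "index_of X pt x < card X" "pt (index_of X pt x) = x"
proof -
  have inj: "inj_on pt {..<card X}" and x_in: "x \<in> pt ` {..<card X}"
    using bij x_in by (auto simp: bij_betw_def)
  show "index_of X pt x < card X" unfolding index_of_def
    using the_inv_into_into[OF inj x_in order_refl] by simp
  show "pt (index_of X pt x) = x" unfolding index_of_def using inj x_in by (rule f_the_inv_into_f)
qed

lemma index_of_pt: "bij_betw pt {..<card X} X \<Longrightarrow> i < card X \<Longrightarrow> index_of X pt (pt i) = i"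
  unfolding index_of_def by (intro the_inv_into_f_f) (auto simp: bij_betw_def)

section \<open>The approximation algorithm\<close>

fun round_limit :: "nat \<Rightarrow> bexp \<Rightarrow> nat" where
  "round_limit n (NLess (NVar x) (NVar y)) =
     (if y \<in> {''n'', ''missing''} then n else if x = ''out'' then n * n else floorlog 2 (n * n))"
| "round_limit n _ = 1"

definition index_clustering :: "'a set \<Rightarrow> (nat \<Rightarrow> 'a) \<Rightarrow> 'a clustering \<Rightarrow> nat clustering" where
  "index_clustering X pt \<C> = ({i. i < card X \<and> pt i \<in> fst \<C>}, \<lambda>i. index_of X pt (snd \<C> (pt i)))"

lemma corresponds_index_clustering:
  assumes bij: "bij_betw pt {..<card X} X" and clustering: "is_clustering X k \<C>"
  shows "corresponds {..<card X} pt (index_clustering X pt \<C>) \<C>"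
proof -
  have ptX: "pt i \<in> X" if "i < card X" for i using bij that by (auto simp: bij_betw_def)
  have label: "snd \<C> x \<in> X" if "x \<in> X" for x using clustering that by (auto simp: is_clustering_def)
  have "fst \<C> \<subseteq> pt ` {i. i < card X \<and> pt i \<in> fst \<C>}"
    using clustering bij by (auto simp: is_clustering_def bij_betw_def)
  then show ?thesis
    using ptX label index_of[OF bij] by (auto simp: corresponds_def index_clustering_def)
qed

lemma corresponds_lc_output:
  assumes bij: "bij_betw pt {..<card X} X"
    and sol: "is_clustering {..<card X} k (support (card X) (narr s ''C''), narr s ''lC'')"
  shows "corresponds {..<card X} pt (support (card X) (narr s ''C''), narr s ''lC'') (lc_output X pt s)"
  using sol index_of_pt[OF bij]
  by (auto simp: corresponds_def lc_output_def is_clustering_def support_def)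

lemma cluster_solves_instance:
  assumes inst: "lc_instance X d k b \<H>" and bij: "bij_betw pt {..<card X} X"
  shows "halts (round_limit (card X)) cluster_com (lc_input X d pt k b \<H>)
    (\<lambda>s. lc_feasible X k b \<H> (lc_output X pt s) \<and>
      cost_inf X d (lc_output X pt s) \<le> 3 * lc_opt X d k b \<H>)"
proof -
  define n where "n = card X"
  let ?D = "\<lambda>i j. d (pt i) (pt j)" and ?\<H> = "index_clustering X pt \<H>"
  note bij_n = bij[folded n_def]
  have corr: "corresponds {..<n} pt ?\<H> \<H>"
    unfolding n_def using inst
    by (intro corresponds_index_clustering[OF bij, of k]) (simp add: lc_instance_def)
  have inst_n: "lc_instance {..<n} ?D k b ?\<H>"
    using bij_n corr inst by (rule lc_instance_corresponds)
  then have nn_pos: "0 < n * n" by (cases n) (auto simp: lc_instance_def is_clustering_def)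
  have log: "n * n < 2 ^ floorlog 2 (n * n)"
    using floorlog_bounds[OF nn_pos, of 2] by simp
  interpret indexed_instance n ?D k b ?\<H> "round_limit n"
    by unfold_locales (use inst_n in simp_all)
  show ?thesis unfolding n_def[symmetric]
  proof (rule halts_conseq[OF cluster_correct])
    fix i j assume "i < n" "j < n"
    then show "rarr (lc_input X d pt k b \<H>) ''d'' (i * n + j) = ?D i j"
      using row_major_less[of i n j] by (simp add: lc_input_def n_def[symmetric] Let_def)
  next
    fix s :: store assume "solution (3 * lc_opt {..<n} ?D k b ?\<H>) (narr s ''C'') (narr s ''lC'')"
    then have sol: "lc_feasible {..<n} k b ?\<H> (support n (narr s ''C''), narr s ''lC'')"
      "cost_inf {..<n} ?D (support n (narr s ''C''), narr s ''lC'') \<le> 3 * lc_opt {..<n} ?D k b ?\<H>"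
      by (simp_all add: solution_def)
    then have out: "corresponds {..<n} pt (support n (narr s ''C''), narr s ''lC'') (lc_output X pt s)"
      unfolding n_def by (intro corresponds_lc_output[OF bij]) (auto simp: lc_feasible_def)
    show "lc_feasible X k b \<H> (lc_output X pt s) \<and>
      cost_inf X d (lc_output X pt s) \<le> 3 * lc_opt X d k b \<H>"
      using sol lc_feasible_corresponds[OF bij_n corr out] cost_inf_corresponds[OF bij_n out, of d]
        lc_opt_corresponds_le[OF bij_n corr inst] by simp
  qed (use log in \<open>auto simp: lc_input_def n_def[symmetric] Let_def support_def index_clustering_def\<close>)
qed

lemma round_limit_pos: "0 < n \<Longrightarrow> 0 < round_limit n p"
  by (induction n p rule: round_limit.induct) (auto simp: floorlog_def)

lemma iterations_cluster:
  assumes "0 < n"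
  shows "iterations (round_limit n) cluster_com \<le> n * n * floorlog 2 (n * n)"
proof -
  have "0 < floorlog 2 (n * n)" using assms by (simp add: floorlog_def)
  then show ?thesis
    using assms
    by (simp add: cluster_com_def rows_com_def copy_array_com_def sort_com_def
        merge_pass_com_def merge_step_com_def next_runs_com_def merge_least_com_def
        search_com_def probe_com_def bisect_com_def check_com_def select_com_def prepare_com_def
        reset_com_def net_com_def extend_net_com_def cover_com_def weights_com_def
        centers_com_def assign_center_com_def best_center_com_def heaviest_com_def fill_com_def
        add_center_com_def label_com_def output_com_def Suc_le_eq)
qed

lemma cluster_time:
  assumes "2 \<le> n"
  shows "real (time_bound (round_limit n) cluster_com) \<le>
    3 * time_bound (\<lambda>_. 1) cluster_com * ((real n)\<^sup>2 * log 2 n)"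
proof -
  let ?K = "time_bound (\<lambda>_. 1) cluster_com"
  have n_bounds: "0 < n" "1 \<le> log 2 n" using assms by (simp_all add: le_log_iff)
  have "floorlog 2 (n * n) \<le> log 2 (n * n) + 1"
    using n_bounds by (simp add: floorlog_def of_nat_floor log_mult)
  also have "\<dots> \<le> 3 * log 2 n" using n_bounds by (simp add: log_mult)
  finally have log: "floorlog 2 (n * n) \<le> 3 * log 2 n" .
  have "time_bound (round_limit n) cluster_com \<le> ?K * iterations (round_limit n) cluster_com"
    using round_limit_pos[OF n_bounds(1)] by (rule time_bound_le_iterations)
  also have "\<dots> \<le> ?K * (n * n * floorlog 2 (n * n))"
    using iterations_cluster[OF n_bounds(1)] by (rule mult_le_mono2)
  finally have "real (time_bound (round_limit n) cluster_com) \<le> ?K * ((real n)\<^sup>2 * floorlog 2 (n * n))"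
    by (simp add: power2_eq_square flip: of_nat_mult)
  also have "\<dots> \<le> ?K * ((real n)\<^sup>2 * (3 * log 2 n))"
    using log by (intro mult_left_mono) simp_all
  finally show ?thesis by (simp add: mult_ac)
qed

theorem theorem3:
  shows "\<exists>(P :: com) (c :: real) (n\<^sub>0 :: nat).
    \<forall>(X :: 'a set) (d :: 'a \<Rightarrow> 'a \<Rightarrow> real) (pt :: nat \<Rightarrow> 'a) (k :: nat) (b :: nat) (\<H> :: 'a clustering).
      lc_instance X d k b \<H> \<and> bij_betw pt {..<card X} X \<longrightarrow>
      (\<exists>(t :: nat) (s :: store).
         exec P (lc_input X d pt k b \<H>) t s \<and>
         lc_feasible X k b \<H> (lc_output X pt s) \<and>
         cost_inf X d (lc_output X pt s) \<le> 3 * lc_opt X d k b \<H> \<and>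
         (n\<^sub>0 \<le> card X \<longrightarrow>
            real t \<le> c * ((real (card X))\<^sup>2 * log 2 (real (card X))
                          + real (card X) * real k * log 2 (real (card X)))))"
proof (rule exI[of _ cluster_com], rule exI[of _ "3 * real (time_bound (\<lambda>_. 1) cluster_com)"],
    rule exI[of _ 2], intro allI impI, elim conjE)
  fix X :: "'a set" and d :: "'a \<Rightarrow> 'a \<Rightarrow> real" and pt k b and \<H> :: "'a clustering"
  let ?n = "card X" and ?c = "3 * real (time_bound (\<lambda>_. 1) cluster_com)"
  assume inst: "lc_instance X d k b \<H>" "bij_betw pt {..<?n} X"
  obtain t s where run: "exec cluster_com (lc_input X d pt k b \<H>) t s"
    "lc_feasible X k b \<H> (lc_output X pt s)" "cost_inf X d (lc_output X pt s) \<le> 3 * lc_opt X d k b \<H>"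
    and time: "t \<le> time_bound (round_limit ?n) cluster_com"
    using cluster_solves_instance[OF inst] by (blast elim: haltsE)
  have "real t \<le> ?c * ((real ?n)\<^sup>2 * log 2 ?n + real ?n * real k * log 2 ?n)" if "2 \<le> ?n"
  proof -
    have "real t \<le> ?c * ((real ?n)\<^sup>2 * log 2 ?n)"
      using time cluster_time[OF that] by linarith
    also have "\<dots> \<le> ?c * ((real ?n)\<^sup>2 * log 2 ?n + real ?n * real k * log 2 ?n)"
      using that by (intro mult_left_mono) simp_all
    finally show ?thesis .
  qed
  then show "\<exists>(t :: nat) (s :: store). exec cluster_com (lc_input X d pt k b \<H>) t s \<and>
      lc_feasible X k b \<H> (lc_output X pt s) \<and> cost_inf X d (lc_output X pt s) \<le> 3 * lc_opt X d k b \<H> \<and>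
      (2 \<le> ?n \<longrightarrow> real t \<le> ?c * ((real ?n)\<^sup>2 * log 2 (real ?n) + real ?n * real k * log 2 (real ?n)))"
    using run by blast
qed

end
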